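(* There exists a universal constant $c>0$ (in particular independent of the dimension) such that for every integer $d\ge1$, if $\mu$ denotes the probability measure on $\mathbf R^d$ with $\mu(dx)\propto\exp(-|x|^4/4)\,dx$, then for any $f\in\mathcal C_c^\infty(\mathbf R^d,\mathbf R)$, $$\mathrm{Ent}_\mu(f^2)\le c\int_{\mathbf R^d}|\nabla f|^2\,d\mu.$$
   Context: $|\cdot|$ is the Euclidean norm on $\mathbf R^d$; $\mathcal C_c^\infty(\mathbf R^d,\mathbf R)$ is the set of compactly supported smooth functions. $\mathrm{Ent}_\mu(f^2)=\int_{\mathbf R^d}f^2\log(f^2)\,d\mu-\left(\int_{\mathbf R^d}f^2\,d\mu\right)\log\left(\int_{\mathbf R^d}f^2\,d\mu\right)$, with $0\log0=0$. *)

theory Defs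
  imports "HOL-Probability.Probability"
begin

text \<open>
  A statement of the form "there is a constant such that for every dimension \<open>d\<close>" needs \<open>d\<close> to
  be a term, so Euclidean \<open>d\<close>-space is the set \<open>{..<d} \<rightarrow>\<^sub>E UNIV\<close> of functions rather than a
  type. Lebesgue measure is the product measure \<open>lborel_dim d\<close>, whose underlying space is
  \<open>dim_space d\<close>; topological notions are those of the product topology on \<open>nat \<Rightarrow> real\<close>, which
  induces the Euclidean topology on the closed set \<open>dim_space d\<close>. Functions on \<open>d\<close>-space matter
  only on \<open>dim_space d\<close>; this set is stable under \<open>x \<mapsto> x(i := t)\<close> for \<open>i < d\<close>.
\<close>

abbreviation dim_space :: "nat \<Rightarrow> (nat \<Rightarrow> real) set" where
  "dim_space d \<equiv> {..<d} \<rightarrow>\<^sub>E UNIV"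

abbreviation lborel_dim :: "nat \<Rightarrow> (nat \<Rightarrow> real) measure" where
  "lborel_dim d \<equiv> Pi\<^sub>M {..<d} (\<lambda>_. lborel)"

abbreviation eucl_norm :: "nat \<Rightarrow> (nat \<Rightarrow> real) \<Rightarrow> real" where
  "eucl_norm d x \<equiv> L2_set x {..<d}"

definition partial_deriv :: "nat \<Rightarrow> ((nat \<Rightarrow> real) \<Rightarrow> real) \<Rightarrow> (nat \<Rightarrow> real) \<Rightarrow> real" where
  "partial_deriv i f x = deriv (\<lambda>t. f (x(i := t))) (x i)"

definition grad :: "nat \<Rightarrow> ((nat \<Rightarrow> real) \<Rightarrow> real) \<Rightarrow> (nat \<Rightarrow> real) \<Rightarrow> (nat \<Rightarrow> real)" where
  "grad d f x = (\<lambda>i\<in>{..<d}. partial_deriv i f x)"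

text \<open>All partial derivatives of order at most \<open>k\<close> in the \<open>d\<close> coordinates exist and are continuous.\<close>

primrec C_k :: "nat \<Rightarrow> nat \<Rightarrow> ((nat \<Rightarrow> real) \<Rightarrow> real) \<Rightarrow> bool" where
  "C_k d 0 f \<longleftrightarrow> continuous_on (dim_space d) f"
| "C_k d (Suc k) f \<longleftrightarrow> continuous_on (dim_space d) f \<and>
     (\<forall>i<d. (\<forall>x\<in>dim_space d. (\<lambda>t. f (x(i := t))) field_differentiable at (x i)) \<and>
            C_k d k (partial_deriv i f))"

definition Cc_infinity :: "nat \<Rightarrow> ((nat \<Rightarrow> real) \<Rightarrow> real) set" where
  "Cc_infinity d = {f. (\<forall>k. C_k d k f) \<and> compact (closure {x \<in> dim_space d. f x \<noteq> 0})}"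

definition quartic_measure :: "nat \<Rightarrow> (nat \<Rightarrow> real) measure" where
  "quartic_measure d =
     density (lborel_dim d)
       (\<lambda>x. ennreal (exp (- (eucl_norm d x ^ 4 / 4)) /
                     (\<integral>y. exp (- (eucl_norm d y ^ 4 / 4)) \<partial>lborel_dim d)))"

text \<open>The convention \<open>0 log 0 = 0\<close> holds automatically, as \<open>ln\<close> is total.\<close>

definition Ent :: "'a measure \<Rightarrow> ('a \<Rightarrow> real) \<Rightarrow> real" where
  "Ent M g = (\<integral>x. g x * ln (g x) \<partial>M) - (\<integral>x. g x \<partial>M) * ln (\<integral>x. g x \<partial>M)"

lemma quartic_integrable:
  "integrable (lborel_dim d) (\<lambda>x. exp (- (eucl_norm d x ^ 4 / 4)))"
proof (rule Bochner_Integration.integrable_bound)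
  interpret product_sigma_finite "\<lambda>_::nat. lborel :: real measure"
    by standard
  have "(\<lambda>t::real. exp (- t\<^sup>2)) = (\<lambda>t. sqrt pi * normal_density 0 (1 / sqrt 2) t)"
    by (simp add: normal_density_def power_divide fun_eq_iff)
  then have g: "integrable lborel (\<lambda>t::real. exp (- t\<^sup>2))"
    by (simp only:) (intro integrable_mult_right integrable_normal_density; simp)
  show "integrable (lborel_dim d) (\<lambda>x. exp 1 * (\<Prod>i<d. exp (- (x i)\<^sup>2)))"
    using g by (intro integrable_mult_right product_integrable_prod) auto
  show "(\<lambda>x. exp (- (eucl_norm d x ^ 4 / 4))) \<in> borel_measurable (lborel_dim d)"
    unfolding L2_set_def by measurable
  show "AE x in lborel_dim d. norm (exp (- (eucl_norm d x ^ 4 / 4)))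
          \<le> norm (exp 1 * (\<Prod>i<d. exp (- (x i)\<^sup>2)))"
  proof (rule AE_I2)
    fix x :: "nat \<Rightarrow> real"
    define s where "s = (\<Sum>i<d. (x i)\<^sup>2)"
    have s: "eucl_norm d x ^ 2 = s"
      by (simp add: L2_set_def s_def sum_nonneg)
    have "eucl_norm d x ^ 4 = s\<^sup>2"
      by (simp flip: s power_mult)
    moreover have "- (s\<^sup>2 / 4) \<le> 1 - s"
      using zero_le_power2[of "s / 2 - 1"] by (simp add: power2_eq_square algebra_simps)
    ultimately show "norm (exp (- (eucl_norm d x ^ 4 / 4)))
        \<le> norm (exp 1 * (\<Prod>i<d. exp (- (x i)\<^sup>2)))"
      by (simp add: exp_sum[symmetric] sum_negf s_def flip: exp_add)
  qed
qed

lemma prob_space_quartic_measure: "prob_space (quartic_measure d)"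
proof
  interpret product_sigma_finite "\<lambda>_::nat. lborel :: real measure"
    by standard
  let ?h = "\<lambda>x. exp (- (eucl_norm d x ^ 4 / 4))"
  let ?Z = "\<integral>y. ?h y \<partial>lborel_dim d"
  have m[measurable]: "?h \<in> borel_measurable (lborel_dim d)"
    using quartic_integrable by (rule borel_measurable_integrable)
  have space_nz: "emeasure (lborel_dim d) (space (lborel_dim d)) \<noteq> 0"
    using emeasure_PiM[of "{..<d}" "\<lambda>_. UNIV"] by (simp add: space_PiM)
  have "?Z \<noteq> 0"
    using integral_nonneg_eq_0_iff_AE[OF quartic_integrable[of d]] space_nz
    by (auto simp: AE_iff_null)
  moreover have "?Z \<ge> 0"
    by (simp add: integral_nonneg_AE)
  ultimately have Z: "?Z > 0" by linarith
  have "(\<integral>\<^sup>+x. ennreal (?h x / ?Z) \<partial>lborel_dim d) = ennreal (\<integral>x. ?h x / ?Z \<partial>lborel_dim d)"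
    using quartic_integrable[of d] Z by (intro nn_integral_eq_integral) auto
  also have "\<dots> = 1" using Z by simp
  finally show "emeasure (quartic_measure d) (space (quartic_measure d)) = 1"
    unfolding quartic_measure_def by (simp add: emeasure_density cong: nn_integral_cong_simp)
qed

end

theory Submission
  imports Defs "HOL-Real_Asymp.Real_Asymp"
begin

text \<open>
  The potential \<open>V x = |x| ^ 4 / 4\<close> is convex, but its Hessian vanishes at the origin, so the
  Bakry--Emery criterion does not apply to it directly. However, replacing \<open>V\<close> inside the unit ball
  by the paraboloid \<open>|x|\<^sup>2 / 2 - 1 / 4\<close> gives a potential \<open>U\<close> (\<open>convexified_quartic\<close>) such that
  \<open>U - |x|\<^sup>2 / 2\<close> is convex and \<open>U \<le> V \<le> U + 1 / 4\<close>, in every dimension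
  (\<open>strongly_convex_convexified_quartic\<close>, \<open>convexified_quartic_bounds\<close>). A measure with
  potential \<open>U\<close> satisfies a logarithmic Sobolev inequality with constant 2, and by the perturbation
  principle of Holley and Stroock (\<open>holley_stroock\<close>) a bounded change of the potential changes
  the constant only by a bounded factor. This gives the constant \<open>2 exp (1 / 2)\<close>.
  
  The inequality for strongly log-concave measures (\<open>log_sobolev_strongly_convex\<close>) follows the
  argument of Bobkov and Ledoux: it is the first-order term, as the weight of one of the two
  functions tends to zero, of the Prekopa--Leindler inequality (\<open>prekopa_leindler\<close>) applied to
  perturbations of \<open>exp (- U)\<close> (\<open>exponential_prekopa_leindler\<close>,
  \<open>log_sobolev_strongly_convex_exp\<close>). The Prekopa--Leindler inequality is an induction on the dimension
  through Fubini's theorem, starting from the Brunn--Minkowski inequality on the line. The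
  smoothness of \<open>f\<close> enters through a quadratic upper expansion of \<open>ln (f\<^sup>2 + \<epsilon>)\<close>
  (\<open>log_square_semiconcave\<close>), and \<open>\<epsilon>\<close> is sent to zero at the end.
\<close>

section \<open>The Prekopa--Leindler inequality\<close>

lemma emeasure_lborel_affine_preimage:
  fixes c y :: real
  assumes [measurable]: "E \<in> sets borel" and c: "c > 0"
  shows "emeasure lborel {x. (x - y) / c \<in> E} = ennreal c * emeasure lborel E"
proof -
  have "emeasure lborel {x. (x - y) / c \<in> E} = (\<integral>\<^sup>+x. indicator {x. (x - y) / c \<in> E} x \<partial>lborel)"
    by simp
  also have "\<dots> = ennreal c * (\<integral>\<^sup>+x. indicator {x. (x - y) / c \<in> E} (y + c * x) \<partial>lborel)"
    using c by (subst nn_integral_real_affine[where c=c and t=y]) auto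
  also have "(\<lambda>x. indicator {x. (x - y) / c \<in> E} (y + c * x)) = (indicator E :: real \<Rightarrow> ennreal)"
    using c by (auto simp: indicator_def)
  finally show ?thesis by simp
qed

text \<open>
  The cut points are taken in \<open>A\<close> itself, so that the truncated set \<open>A \<inter> {..a}\<close> attains its
  supremum \<open>a\<close>. This replaces inner approximation by compact sets in the proof of
  \<open>brunn_minkowski_1d\<close>.
\<close>

lemma emeasure_eq_SUP_atMost:
  fixes A :: "real set"
  assumes [measurable]: "A \<in> sets borel" and "A \<noteq> {}"
  shows "emeasure lborel A = (SUP a\<in>A. emeasure lborel (A \<inter> {..a}))"
proof (rule antisym)
  show "(SUP a\<in>A. emeasure lborel (A \<inter> {..a})) \<le> emeasure lborel A"
    by (intro SUP_least emeasure_mono) auto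
  show "emeasure lborel A \<le> (SUP a\<in>A. emeasure lborel (A \<inter> {..a}))"
  proof (cases "\<exists>a\<in>A. \<forall>x\<in>A. x \<le> a")
    case True
    then obtain a where a: "a \<in> A" "\<forall>x\<in>A. x \<le> a" by blast
    then have "A \<inter> {..a} = A" by auto
    with a show ?thesis by (intro SUP_upper2[of a]) auto
  next
    case False
    obtain f :: "nat \<Rightarrow> ereal" where f: "incseq f" "range f \<subseteq> ereal ` A" "Sup (ereal ` A) = (SUP i. f i)"
      using Sup_countable_SUP[of "ereal ` A"] assms(2) by auto
    then obtain a where a: "\<And>i. f i = ereal (a i)" "\<And>i. a i \<in> A"
    proof -
      have "\<forall>i. \<exists>a. a \<in> A \<and> f i = ereal a" using f(2) by blast
      then have "\<exists>a. \<forall>i. a i \<in> A \<and> f i = ereal (a i)" by (rule choice)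
      then show ?thesis using that by blast
    qed
    have inc: "incseq a" using f(1) by (auto simp: incseq_def a)
    have "A = (\<Union>i. A \<inter> {..a i})"
    proof safe
      fix x assume x: "x \<in> A"
      with False obtain y where y: "y \<in> A" "x < y" by (meson not_le)
      then have "ereal x < (SUP i. f i)"
        using Sup_upper[of "ereal y" "ereal ` A"] by (metis f(3) imageI less_ereal.simps(1) less_le_trans)
      then obtain i where "ereal x < f i" by (auto simp: less_SUP_iff)
      then show "x \<in> (\<Union>i. A \<inter> {..a i})" using x by (auto simp: a intro!: exI[of _ i])
    qed
    then have "emeasure lborel A = (SUP i. emeasure lborel (A \<inter> {..a i}))"
      using inc by (subst SUP_emeasure_incseq) (auto simp: incseq_def, force)
    also have "\<dots> \<le> (SUP a\<in>A. emeasure lborel (A \<inter> {..a}))"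
      using a(2) by (auto intro!: SUP_least SUP_upper)
    finally show ?thesis .
  qed
qed

lemma emeasure_eq_SUP_atLeast:
  fixes A :: "real set"
  assumes [measurable]: "A \<in> sets borel" and "A \<noteq> {}"
  shows "emeasure lborel A = (SUP a\<in>A. emeasure lborel (A \<inter> {a..}))"
proof -
  have reflect: "emeasure lborel (uminus -` E) = emeasure lborel E" if [measurable]: "E \<in> sets borel" for E :: "real set"
    using emeasure_distr[of uminus lborel borel E] that
    by (simp add: vimage_def lborel_distr_uminus)
  have im: "uminus -` A = uminus ` A" by (auto simp: image_iff intro!: exI[of _ "- x" for x]) (metis minus_minus)
  have "emeasure lborel A = emeasure lborel (uminus -` A)" by (simp add: reflect)
  also have "\<dots> = (SUP a\<in>uminus -` A. emeasure lborel (uminus -` A \<inter> {..a}))"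
  proof (rule emeasure_eq_SUP_atMost)
    have "uminus -` A \<inter> space borel \<in> sets borel" by (rule measurable_sets[of _ _ borel]) simp_all
    then show "uminus -` A \<in> sets borel" by simp
    show "uminus -` A \<noteq> {}" using assms(2) by (simp add: im)
  qed
  also have "\<dots> = (SUP a\<in>A. emeasure lborel (uminus -` A \<inter> {..-a}))"
    by (simp add: im image_image)
  also have "\<dots> = (SUP a\<in>A. emeasure lborel (A \<inter> {a..}))"
  proof (rule SUP_cong[OF refl])
    fix a
    have "uminus -` A \<inter> {..-a} = uminus -` (A \<inter> {a..})" by auto
    then show "emeasure lborel (uminus -` A \<inter> {..-a}) = emeasure lborel (A \<inter> {a..})" by (simp add: reflect del: vimage_Int)
  qed
  finally show ?thesis .
qed

text \<open>
  If \<open>a\<close> is the largest point of \<open>A\<close> and \<open>b\<close> the smallest point of \<open>B\<close>, then \<open>C\<close> contains the two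
  translates \<open>t A + s b\<close> and \<open>t a + s B\<close>. The first lies to the left of \<open>t a + s b\<close> and the second
  to the right, so their measures add up. General sets are exhausted by truncations at points
  \<open>a \<in> A\<close> and \<open>b \<in> B\<close>.
\<close>

lemma brunn_minkowski_1d:
  fixes A B C :: "real set" and t s :: real
  assumes [measurable]: "A \<in> sets borel" "B \<in> sets borel" "C \<in> sets borel"
    and ne: "A \<noteq> {}" "B \<noteq> {}" and ts: "t > 0" "s > 0"
    and C: "\<And>a b. a \<in> A \<Longrightarrow> b \<in> B \<Longrightarrow> t * a + s * b \<in> C"
  shows "ennreal t * emeasure lborel A + ennreal s * emeasure lborel B \<le> emeasure lborel C"
proof -
  have 1: "ennreal t * emeasure lborel (A \<inter> {..a}) + ennreal s * emeasure lborel (B \<inter> {b..}) \<le> emeasure lborel C"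
    if a: "a \<in> A" and b: "b \<in> B" for a b
  proof -
    define A1 where "A1 = {x. (x - s * b) / t \<in> A \<inter> {..a}}"
    define B1 where "B1 = {x. (x - t * a) / s \<in> B \<inter> {b..}}"
    have [measurable]: "A1 \<in> sets borel" "B1 \<in> sets borel" by (auto simp: A1_def B1_def)
    have "A1 \<inter> B1 \<subseteq> {t * a + s * b}"
      using ts by (auto simp: A1_def B1_def field_simps)
    then have "emeasure lborel (A1 \<inter> B1) \<le> emeasure lborel {t * a + s * b}" by (intro emeasure_mono) auto
    then have 0: "emeasure lborel (A1 \<inter> B1) = 0" by simp
    have sub: "A1 \<union> B1 \<subseteq> C"
    proof safe
      fix x assume "x \<in> A1"
      then show "x \<in> C" using C[of "(x - s * b) / t" b] b ts by (auto simp: A1_def)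
    next
      fix x assume "x \<in> B1"
      then show "x \<in> C" using C[of a "(x - t * a) / s"] a ts by (auto simp: B1_def)
    qed
    have "ennreal t * emeasure lborel (A \<inter> {..a}) + ennreal s * emeasure lborel (B \<inter> {b..}) = emeasure lborel A1 + emeasure lborel B1"
      unfolding A1_def B1_def using ts by (subst (1 2) emeasure_lborel_affine_preimage) auto
    also have "\<dots> = emeasure lborel (A1 \<union> B1)"
      using emeasure_Un_Int[of A1 lborel B1] 0 by simp
    also have "\<dots> \<le> emeasure lborel C" using sub by (intro emeasure_mono) auto
    finally show ?thesis .
  qed
  have "ennreal t * emeasure lborel A + ennreal s * emeasure lborel B =
     (SUP a\<in>A. SUP b\<in>B. ennreal t * emeasure lborel (A \<inter> {..a}) + ennreal s * emeasure lborel (B \<inter> {b..}))"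
    unfolding emeasure_eq_SUP_atMost[OF assms(1) ne(1)] emeasure_eq_SUP_atLeast[OF assms(2) ne(2)]
    using ne by (simp add: SUP_mult_left_ennreal flip: ennreal_SUP_add_left ennreal_SUP_add_right)
  also have "\<dots> \<le> emeasure lborel C" by (intro SUP_least 1)
  finally show ?thesis .
qed

lemma nn_integral_layer_cake:
  fixes f :: "'a \<Rightarrow> ennreal"
  assumes "sigma_finite_measure M" and [measurable]: "f \<in> borel_measurable M"
  shows "(\<integral>\<^sup>+x. f x \<partial>M) =
    (\<integral>\<^sup>+\<tau>. indicator {0..} \<tau> * emeasure M {x\<in>space M. ennreal \<tau> < f x} \<partial>lborel)"
proof -
  interpret M: sigma_finite_measure M by fact
  interpret pair_sigma_finite lborel M by standard
  have *: "f x = (\<integral>\<^sup>+\<tau>. indicator {0..} \<tau> * indicator {y\<in>space M. ennreal \<tau> < f y} x \<partial>lborel)"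
    if "x \<in> space M" for x
  proof -
    have "(\<integral>\<^sup>+\<tau>. indicator {0..} \<tau> * indicator {y\<in>space M. ennreal \<tau> < f y} x \<partial>lborel)
      = (\<integral>\<^sup>+\<tau>. indicator {\<tau>. 0 \<le> \<tau> \<and> ennreal \<tau> < f x} \<tau> \<partial>lborel)"
      using that by (intro nn_integral_cong) (auto simp: indicator_def)
    also have "\<dots> = emeasure lborel {\<tau>. 0 \<le> \<tau> \<and> ennreal \<tau> < f x}"
      by (intro nn_integral_indicator) simp
    also have "\<dots> = f x"
    proof (cases "f x")
      case (real r)
      then have "{\<tau>. 0 \<le> \<tau> \<and> ennreal \<tau> < f x} = {0..<r}" by (auto simp: ennreal_less_iff)
      then show ?thesis using real by simp
    next
      case top
      then have "{\<tau>. 0 \<le> \<tau> \<and> ennreal \<tau> < f x} = {0..}" by auto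
      moreover have "emeasure lborel {0::real..} = \<infinity>"
      proof -
        have "ennreal (real n) \<le> emeasure lborel {0::real..}" for n
          using emeasure_mono[of "{0..real n}" "{0..}" lborel] by simp
        then show ?thesis by (metis SUP_least ennreal_SUP_of_nat_eq_top ennreal_of_nat_eq_real_of_nat infinity_ennreal_def neq_top_trans)
      qed
      ultimately show ?thesis using top by simp
    qed
    finally show ?thesis by simp
  qed
  have "(\<integral>\<^sup>+x. f x \<partial>M) = (\<integral>\<^sup>+x. (\<integral>\<^sup>+\<tau>. indicator {0..} \<tau> * indicator {y\<in>space M. ennreal \<tau> < f y} x \<partial>lborel) \<partial>M)"
    by (rule nn_integral_cong) (rule *)
  also have "\<dots> = (\<integral>\<^sup>+\<tau>. (\<integral>\<^sup>+x. indicator {0..} \<tau> * indicator {y\<in>space M. ennreal \<tau> < f y} x \<partial>M) \<partial>lborel)"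
  proof (rule Fubini')
    have "(\<lambda>(\<tau>, x). if 0 \<le> \<tau> \<and> ennreal \<tau> < f x then 1 else (0::ennreal)) \<in> borel_measurable (lborel \<Otimes>\<^sub>M M)"
      by measurable
    then show "(\<lambda>(\<tau>, x). indicator {0..} \<tau> * indicator {y\<in>space M. ennreal \<tau> < f y} x :: ennreal) \<in> borel_measurable (lborel \<Otimes>\<^sub>M M)"
      by (rule measurable_cong[THEN iffD1, rotated]) (auto simp: space_pair_measure indicator_def)
  qed
  also have "\<dots> = (\<integral>\<^sup>+\<tau>. indicator {0..} \<tau> * emeasure M {x\<in>space M. ennreal \<tau> < f x} \<partial>lborel)"
    by (rule nn_integral_cong, subst nn_integral_cmult) auto
  finally show ?thesis .
qed

text \<open>
  Superlevel sets of level \<open>\<tau> < 1\<close> are nonempty for both \<open>u\<close> and \<open>v\<close> because both have supremum one;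
  the normalization is what allows Brunn--Minkowski to be applied at every level before
  integrating over \<open>\<tau>\<close>. The conclusion is additive; the multiplicative form follows from it by
  the inequality between weighted arithmetic and geometric means.
\<close>

lemma prekopa_leindler_1d_normalized:
  fixes u v w :: "real \<Rightarrow> ennreal" and t s :: real
  assumes [measurable]: "u \<in> borel_measurable borel" "v \<in> borel_measurable borel" "w \<in> borel_measurable borel"
    and ts: "t > 0" "s > 0"
    and u1: "(SUP x. u x) = 1" and v1: "(SUP x. v x) = 1"
    and w: "\<And>\<tau> x y. \<lbrakk>0 \<le> \<tau>; \<tau> < 1; ennreal \<tau> < u x; ennreal \<tau> < v y\<rbrakk> \<Longrightarrow> ennreal \<tau> < w (t * x + s * y)"
  shows "ennreal t * (\<integral>\<^sup>+x. u x \<partial>lborel) + ennreal s * (\<integral>\<^sup>+x. v x \<partial>lborel) \<le> (\<integral>\<^sup>+x. w x \<partial>lborel)"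
proof -
  have sf: "sigma_finite_measure (lborel :: real measure)" by standard
  have le1: "(\<integral>\<^sup>+x. f x \<partial>lborel) = (\<integral>\<^sup>+\<tau>. indicator {0..<1} \<tau> * emeasure lborel {x. ennreal \<tau> < f x} \<partial>lborel)"
    if [measurable]: "f \<in> borel_measurable borel" and "(SUP x. f x) = 1" for f :: "real \<Rightarrow> ennreal"
  proof -
    have "f x \<le> 1" for x using that(2) by (metis SUP_upper UNIV_I)
    then have "{x. ennreal \<tau> < f x} = {}" if "\<tau> \<ge> 1" for \<tau>
      using that by (metis (mono_tags, lifting) Collect_empty_eq ennreal_1 ennreal_leI leD order_trans)
    then show ?thesis
      by (subst nn_integral_layer_cake[OF sf]) (auto intro!: nn_integral_cong simp: indicator_def)
  qed
  have [measurable]: "(\<lambda>\<tau>. emeasure lborel {x. ennreal \<tau> < f x}) \<in> borel_measurable borel"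
    if [measurable]: "f \<in> borel_measurable borel" for f :: "real \<Rightarrow> ennreal"
  proof (rule lborel.measurable_emeasure)
    show "{p \<in> space (borel \<Otimes>\<^sub>M lborel). snd p \<in> {x. ennreal (fst p) < f x}} \<in> sets (borel \<Otimes>\<^sub>M lborel)"
      by (simp only: mem_Collect_eq) measurable
  qed simp
  have pt: "indicator {0..<1} \<tau> * (ennreal t * emeasure lborel {x. ennreal \<tau> < u x} + ennreal s * emeasure lborel {x. ennreal \<tau> < v x})
     \<le> indicator {0..} \<tau> * emeasure lborel {x. ennreal \<tau> < w x}" for \<tau> :: real
  proof (cases "0 \<le> \<tau> \<and> \<tau> < 1")
    case True
    then have "ennreal \<tau> < (SUP x. u x)" "ennreal \<tau> < (SUP x. v x)" by (simp_all add: u1 v1 ennreal_less_one_iff)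
    then have "{x. ennreal \<tau> < u x} \<noteq> {}" "{x. ennreal \<tau> < v x} \<noteq> {}" by (auto simp: less_SUP_iff)
    then have "ennreal t * emeasure lborel {x. ennreal \<tau> < u x} + ennreal s * emeasure lborel {x. ennreal \<tau> < v x}
       \<le> emeasure lborel {x. ennreal \<tau> < w x}"
      using True w ts by (intro brunn_minkowski_1d) auto
    then show ?thesis using True by simp
  qed auto
  have "ennreal t * (\<integral>\<^sup>+x. u x \<partial>lborel) + ennreal s * (\<integral>\<^sup>+x. v x \<partial>lborel) =
    (\<integral>\<^sup>+\<tau>. indicator {0..<1} \<tau> * (ennreal t * emeasure lborel {x. ennreal \<tau> < u x} + ennreal s * emeasure lborel {x. ennreal \<tau> < v x}) \<partial>lborel)"
    by (simp add: le1 u1 v1 flip: nn_integral_cmult nn_integral_add) (simp add: algebra_simps)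
  also have "\<dots> \<le> (\<integral>\<^sup>+\<tau>. indicator {0..} \<tau> * emeasure lborel {x. ennreal \<tau> < w x} \<partial>lborel)"
    by (intro nn_integral_mono pt)
  also have "\<dots> = (\<integral>\<^sup>+x. w x \<partial>lborel)"
    by (subst (2) nn_integral_layer_cake[OF sf]) auto
  finally show ?thesis .
qed

text \<open>
  With \<open>c\<close> the weighted mean, \<open>c / a = 1 + (b / a - 1) / (m + 1)\<close>, so Bernoulli's inequality gives
  \<open>(c / a) ^ (m + 1) \<ge> b / a\<close>.
\<close>

lemma weighted_am_gm:
  fixes a b :: real
  assumes "a \<ge> 0" "b \<ge> 0"
  shows "a ^ m * b \<le> (real m / real (Suc m) * a + 1 / real (Suc m) * b) ^ Suc m"
proof (cases "a = 0")
  case True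
  show ?thesis
  proof (cases m)
    case 0 then show ?thesis by (simp add: assms)
  next
    case (Suc k) then show ?thesis using assms True by simp
  qed
next
  case False
  with assms have a: "a > 0" by simp
  define c where "c = real m / real (Suc m) * a + 1 / real (Suc m) * b"
  have "c * Suc m = a * (1 + (b / a - 1) / Suc m) * Suc m"
    using a by (simp add: c_def divide_simps) (simp add: algebra_simps)
  then have c: "c = a * (1 + (b / a - 1) / Suc m)" by (simp del: of_nat_Suc)
  have "b / a = 1 + real (Suc m) * ((b / a - 1) / Suc m)" by simp
  also have "\<dots> \<le> (1 + (b / a - 1) / Suc m) ^ Suc m"
  proof (rule Bernoulli_inequality)
    have "- 1 \<le> b / a - 1" using a assms by simp
    also have "- 1 * real (Suc m) \<le> - 1" by simp
    finally (xtrans) show "- 1 \<le> (b / a - 1) / Suc m" by (simp only: pos_le_divide_eq of_nat_0_less_iff zero_less_Suc)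
  qed
  finally have "a ^ Suc m * (b / a) \<le> a ^ Suc m * (1 + (b / a - 1) / Suc m) ^ Suc m"
    using a by (intro mult_left_mono) auto
  also have "\<dots> = c ^ Suc m" unfolding c power_mult_distrib ..
  finally show ?thesis using a by (simp add: c_def)
qed

lemma weighted_am_gm_ennreal:
  fixes X Y :: ennreal
  assumes "m > 0"
  shows "X ^ m * Y \<le> (ennreal (real m / real (Suc m)) * X + ennreal (1 / real (Suc m)) * Y) ^ Suc m"
proof (cases X)
  case X: (real a)
  show ?thesis
  proof (cases Y)
    case Y: (real b)
    have "ennreal (a ^ m * b) \<le> ennreal ((real m / real (Suc m) * a + 1 / real (Suc m) * b) ^ Suc m)"
      using weighted_am_gm X Y by (intro ennreal_leI) auto
    also have "\<dots> = (ennreal (real m / real (Suc m)) * X + ennreal (1 / real (Suc m)) * Y) ^ Suc m"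
      using X Y
      by (subst ennreal_power[symmetric]) (simp_all add: ennreal_plus ennreal_mult[symmetric] del: power_Suc of_nat_Suc)
    finally show ?thesis using X Y by (simp add: ennreal_mult ennreal_power)
  qed (auto simp: ennreal_mult_top top_power_ennreal simp del: power_Suc)
next
  case top
  then show ?thesis using assms by (auto simp: ennreal_mult_top top_power_ennreal simp del: power_Suc)
qed

text \<open>
  Only the weights \<open>m / (m + 1)\<close> and \<open>1 / (m + 1)\<close> occur below. Raising everything to the power
  \<open>m + 1\<close> then turns the geometric mean into \<open>u x ^ m * v y\<close>, which makes sense for
  extended nonnegative values; infinite values do occur, as partial integrals, in the induction on
  the dimension.
  
  Dividing \<open>u\<close>, \<open>v\<close> by their suprema \<open>\<alpha>\<close>, \<open>\<beta>\<close> and \<open>w\<close> by the matching geometric mean \<open>\<gamma>\<close> reduces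
  to the normalized case.
\<close>

lemma prekopa_leindler_1d_bounded:
  fixes u v w :: "real \<Rightarrow> ennreal" and m :: nat
  assumes [measurable]: "u \<in> borel_measurable borel" "v \<in> borel_measurable borel" "w \<in> borel_measurable borel"
    and m: "m > 0"
    and u1: "(SUP x. u x) < \<infinity>" and v1: "(SUP x. v x) < \<infinity>"
    and w: "\<And>x y. u x ^ m * v y \<le> w (real m / real (Suc m) * x + 1 / real (Suc m) * y) ^ Suc m"
  shows "(\<integral>\<^sup>+x. u x \<partial>lborel) ^ m * (\<integral>\<^sup>+x. v x \<partial>lborel) \<le> (\<integral>\<^sup>+x. w x \<partial>lborel) ^ Suc m"
proof (cases "(SUP x. u x) = 0 \<or> (SUP x. v x) = 0")
  case True
  then have "(\<forall>x. u x = 0) \<or> (\<forall>x. v x = 0)" by (metis SUP_upper UNIV_I le_zero_eq)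
  then show ?thesis using m by (auto simp: zero_power)
next
  case False
  obtain \<alpha> where \<alpha>: "(SUP x. u x) = ennreal \<alpha>" "\<alpha> > 0"
    using u1 False by (cases "SUP x. u x") (auto simp: less_le)
  obtain \<beta> where \<beta>: "(SUP x. v x) = ennreal \<beta>" "\<beta> > 0"
    using v1 False by (cases "SUP x. v x") (auto simp: less_le)
  define \<gamma> where "\<gamma> = root (Suc m) (\<alpha> ^ m * \<beta>)"
  have \<gamma>: "\<gamma> ^ Suc m = \<alpha> ^ m * \<beta>" "\<gamma> > 0"
    unfolding \<gamma>_def using \<alpha> \<beta> by (auto simp del: power_Suc)
  define u' where "u' = (\<lambda>x. ennreal (1 / \<alpha>) * u x)"
  define v' where "v' = (\<lambda>x. ennreal (1 / \<beta>) * v x)"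
  define w' where "w' = (\<lambda>x. ennreal (1 / \<gamma>) * w x)"
  let ?t = "real m / real (Suc m)" and ?s = "1 / real (Suc m)"
  have [measurable]: "u' \<in> borel_measurable borel" "v' \<in> borel_measurable borel" "w' \<in> borel_measurable borel"
    by (auto simp: u'_def v'_def w'_def)
  have inv: "ennreal (1 / \<alpha>) ^ m * ennreal (1 / \<beta>) = ennreal (1 / \<gamma>) ^ Suc m"
    using \<alpha> \<beta> \<gamma> by (simp add: ennreal_power power_one_over \<gamma>(1) flip: ennreal_mult del: power_Suc)
  have "ennreal ?t * (\<integral>\<^sup>+x. u' x \<partial>lborel) + ennreal ?s * (\<integral>\<^sup>+x. v' x \<partial>lborel) \<le> (\<integral>\<^sup>+x. w' x \<partial>lborel)"
  proof (rule prekopa_leindler_1d_normalized)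
    show "(SUP x. u' x) = 1" "(SUP x. v' x) = 1"
      unfolding u'_def v'_def using \<alpha> \<beta> by (auto simp: SUP_mult_left_ennreal[symmetric] ennreal_mult[symmetric])
    fix \<tau> x y :: real assume \<tau>: "0 \<le> \<tau>" "\<tau> < 1" "ennreal \<tau> < u' x" "ennreal \<tau> < v' y"
    show "ennreal \<tau> < w' (?t * x + ?s * y)"
    proof (rule ccontr)
      assume "\<not> ?thesis"
      then have "w' (?t * x + ?s * y) ^ Suc m \<le> ennreal \<tau> ^ Suc m"
        by (intro power_mono) auto
      moreover have "ennreal (1 / \<gamma>) ^ Suc m * (u x ^ m * v y) \<le> ennreal (1 / \<gamma>) ^ Suc m * w (?t * x + ?s * y) ^ Suc m"
        by (intro mult_left_mono w) auto
      moreover have "ennreal (1 / \<gamma>) ^ Suc m * (u x ^ m * v y) = u' x ^ m * v' y"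
        unfolding inv[symmetric] u'_def v'_def power_mult_distrib by (simp add: mult_ac)
      moreover have "ennreal (1 / \<gamma>) ^ Suc m * w (?t * x + ?s * y) ^ Suc m = w' (?t * x + ?s * y) ^ Suc m"
        unfolding w'_def power_mult_distrib by simp
      moreover have "ennreal \<tau> ^ Suc m < u' x ^ m * v' y"
      proof -
        have le: "u' x \<le> 1" for x
          using \<open>(SUP x. u' x) = 1\<close> by (metis SUP_upper UNIV_I)
        have "u' x ^ m \<noteq> 0" using \<tau>(3) by (auto simp: power_eq_0_iff)
        moreover have "u' x ^ m < top"
          using le[of x] by (meson ennreal_one_less_top le_less_trans power_le_one zero_le)
        ultimately have "u' x ^ m * ennreal \<tau> < u' x ^ m * v' y"
          using \<tau>(4) by (intro ennreal_mult_strict_left_mono) (auto simp only: zero_less_iff_neq_zero)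
        moreover have "ennreal \<tau> ^ m \<le> u' x ^ m"
          using \<tau>(3) by (intro power_mono) auto
        then have "ennreal \<tau> ^ m * ennreal \<tau> \<le> u' x ^ m * ennreal \<tau>" by (rule mult_right_mono) simp
        ultimately show ?thesis unfolding power_Suc2 by (rule le_less_trans[rotated])
      qed
      ultimately show False by simp
    qed
  qed (use m in auto)
  then have "(ennreal ?t * (\<integral>\<^sup>+x. u' x \<partial>lborel) + ennreal ?s * (\<integral>\<^sup>+x. v' x \<partial>lborel)) ^ Suc m \<le> (\<integral>\<^sup>+x. w' x \<partial>lborel) ^ Suc m"
    by (rule power_mono) simp
  with weighted_am_gm_ennreal[OF m, of "\<integral>\<^sup>+x. u' x \<partial>lborel" "\<integral>\<^sup>+x. v' x \<partial>lborel"]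
  have "(\<integral>\<^sup>+x. u' x \<partial>lborel) ^ m * (\<integral>\<^sup>+x. v' x \<partial>lborel) \<le> (\<integral>\<^sup>+x. w' x \<partial>lborel) ^ Suc m"
    by (rule order_trans)
  then have "ennreal (1 / \<gamma>) ^ Suc m * ((\<integral>\<^sup>+x. u x \<partial>lborel) ^ m * (\<integral>\<^sup>+x. v x \<partial>lborel))
    \<le> ennreal (1 / \<gamma>) ^ Suc m * (\<integral>\<^sup>+x. w x \<partial>lborel) ^ Suc m"
  proof -
    have "(\<integral>\<^sup>+x. u' x \<partial>lborel) = ennreal (1 / \<alpha>) * (\<integral>\<^sup>+x. u x \<partial>lborel)"
      "(\<integral>\<^sup>+x. v' x \<partial>lborel) = ennreal (1 / \<beta>) * (\<integral>\<^sup>+x. v x \<partial>lborel)"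
      "(\<integral>\<^sup>+x. w' x \<partial>lborel) = ennreal (1 / \<gamma>) * (\<integral>\<^sup>+x. w x \<partial>lborel)"
      unfolding u'_def v'_def w'_def by (intro nn_integral_cmult; measurable)+
    moreover assume "(\<integral>\<^sup>+x. u' x \<partial>lborel) ^ m * (\<integral>\<^sup>+x. v' x \<partial>lborel) \<le> (\<integral>\<^sup>+x. w' x \<partial>lborel) ^ Suc m"
    moreover have "(a * U) ^ m * (b * V) = (a ^ m * b) * (U ^ m * V)" for a b U V :: ennreal
      by (simp only: power_mult_distrib ac_simps)
    ultimately show ?thesis by (simp only: inv power_mult_distrib[of _ _ "Suc m"])
  qed
  then have "ennreal (\<gamma> ^ Suc m) * (ennreal (1 / \<gamma>) ^ Suc m * ((\<integral>\<^sup>+x. u x \<partial>lborel) ^ m * (\<integral>\<^sup>+x. v x \<partial>lborel)))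
    \<le> ennreal (\<gamma> ^ Suc m) * (ennreal (1 / \<gamma>) ^ Suc m * (\<integral>\<^sup>+x. w x \<partial>lborel) ^ Suc m)"
    by (rule mult_left_mono) simp
  moreover have "ennreal (\<gamma> ^ Suc m) * ennreal (1 / \<gamma>) ^ Suc m = 1"
    using \<gamma>(2) by (simp add: ennreal_power power_one_over flip: ennreal_mult del: power_Suc)
  ultimately show ?thesis by (simp add: mult.assoc[symmetric] del: power_Suc)
qed

lemma prekopa_leindler_1d:
  fixes u v w :: "real \<Rightarrow> ennreal" and m :: nat
  assumes [measurable]: "u \<in> borel_measurable borel" "v \<in> borel_measurable borel" "w \<in> borel_measurable borel"
    and m: "m > 0"
    and w: "\<And>x y. u x ^ m * v y \<le> w (real m / real (Suc m) * x + 1 / real (Suc m) * y) ^ Suc m"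
  shows "(\<integral>\<^sup>+x. u x \<partial>lborel) ^ m * (\<integral>\<^sup>+x. v x \<partial>lborel) \<le> (\<integral>\<^sup>+x. w x \<partial>lborel) ^ Suc m"
proof -
  have trunc: "(\<lambda>k. \<integral>\<^sup>+x. min (f x) (of_nat k) \<partial>lborel) \<longlonglongrightarrow> (\<integral>\<^sup>+x. f x \<partial>lborel)"
    if [measurable]: "f \<in> borel_measurable borel" for f :: "real \<Rightarrow> ennreal"
  proof (rule nn_integral_LIMSEQ)
    show "incseq (\<lambda>k x. min (f x) (of_nat k))"
      unfolding incseq_def le_fun_def by (intro allI impI min.mono) auto
    fix x
    have "(\<lambda>k. of_nat k :: ennreal) \<longlonglongrightarrow> top"
      using LIMSEQ_SUP[of "of_nat :: nat \<Rightarrow> ennreal"] by (simp add: ennreal_SUP_of_nat_eq_top incseq_def)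
    then have "(\<lambda>k. min (f x) (of_nat k)) \<longlonglongrightarrow> min (f x) top"
      by (intro tendsto_min tendsto_const)
    then show "(\<lambda>k. min (f x) (of_nat k)) \<longlonglongrightarrow> f x" by simp
  qed simp
  have le: "(\<integral>\<^sup>+x. min (u x) (of_nat k) \<partial>lborel) ^ m * (\<integral>\<^sup>+x. min (v x) (of_nat k) \<partial>lborel) \<le> (\<integral>\<^sup>+x. w x \<partial>lborel) ^ Suc m" for k
  proof (rule prekopa_leindler_1d_bounded[OF _ _ _ m])
    have fin: "(SUP x. min (f x) (of_nat k)) < \<infinity>" for f :: "real \<Rightarrow> ennreal"
    proof -
      have "(SUP x. min (f x) (of_nat k)) \<le> of_nat k" by (intro SUP_least) simp
      also have "\<dots> < \<infinity>" by (simp add: of_nat_less_top)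
      finally show ?thesis .
    qed
    show "(SUP x. min (u x) (of_nat k)) < \<infinity>" "(SUP x. min (v x) (of_nat k)) < \<infinity>" by (rule fin)+
    fix x y
    have "min (u x) (of_nat k) ^ m * min (v y) (of_nat k) \<le> u x ^ m * v y"
      by (intro mult_mono power_mono) auto
    also note w[of x y]
    finally show "min (u x) (of_nat k) ^ m * min (v y) (of_nat k) \<le> w (real m / real (Suc m) * x + 1 / real (Suc m) * y) ^ Suc m" .
  qed measurable
  let ?U = "\<integral>\<^sup>+x. u x \<partial>lborel" and ?V = "\<integral>\<^sup>+x. v x \<partial>lborel"
  show ?thesis
  proof (cases "?U = 0 \<or> ?V = 0")
    case True
    then show ?thesis using m by (auto simp: zero_power)
  next
    case False
    have pow: "(\<lambda>k. (\<integral>\<^sup>+x. min (u x) (of_nat k) \<partial>lborel) ^ j) \<longlonglongrightarrow> ?U ^ j" for j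
    proof (induction j)
      case (Suc j)
      then show ?case using False trunc[of u]
        by (simp add: tendsto_mult_ennreal)
    qed simp
    have "(\<lambda>k. (\<integral>\<^sup>+x. min (u x) (of_nat k) \<partial>lborel) ^ m * (\<integral>\<^sup>+x. min (v x) (of_nat k) \<partial>lborel)) \<longlonglongrightarrow> ?U ^ m * ?V"
      using False trunc[of v] pow[of m] by (intro tendsto_mult_ennreal) auto
    then show ?thesis by (rule LIMSEQ_le_const2) (use le in blast)
  qed
qed

text \<open>
  Induction on the dimension. For fixed \<open>x\<close> and \<open>y\<close> in dimension \<open>d\<close>, the one-dimensional inequality in
  the last coordinate says precisely that the partial integrals of \<open>u\<close>, \<open>v\<close>, \<open>w\<close> over that
  coordinate satisfy the hypothesis in dimension \<open>d\<close>.
\<close>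

lemma prekopa_leindler:
  fixes u v w :: "(nat \<Rightarrow> real) \<Rightarrow> ennreal" and m :: nat
  assumes "u \<in> borel_measurable (lborel_dim d)" "v \<in> borel_measurable (lborel_dim d)" "w \<in> borel_measurable (lborel_dim d)"
    and m: "m > 0"
    and "\<And>x y. x \<in> dim_space d \<Longrightarrow> y \<in> dim_space d \<Longrightarrow>
      u x ^ m * v y \<le> w (\<lambda>i\<in>{..<d}. real m / real (Suc m) * x i + 1 / real (Suc m) * y i) ^ Suc m"
  shows "(\<integral>\<^sup>+x. u x \<partial>lborel_dim d) ^ m * (\<integral>\<^sup>+x. v x \<partial>lborel_dim d) \<le> (\<integral>\<^sup>+x. w x \<partial>lborel_dim d) ^ Suc m"
  using assms(1-3,5)
proof (induction d arbitrary: u v w)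
  case 0
  interpret product_sigma_finite "\<lambda>_::nat. lborel :: real measure" by standard
  have "(\<lambda>i\<in>{..<0::nat}. c i) = (\<lambda>_. undefined :: real)" for c by auto
  then show ?case using 0(4)[of "\<lambda>_. undefined" "\<lambda>_. undefined"]
    by (simp add: nn_integral_empty)
next
  case (Suc d)
  interpret product_sigma_finite "\<lambda>_::nat. lborel :: real measure" by standard
  have ins: "{..<Suc d} = insert d {..<d}" by auto

  let ?t = "real m / real (Suc m)" and ?s = "1 / real (Suc m)"
  have split: "(\<integral>\<^sup>+x. f x \<partial>lborel_dim (Suc d)) = (\<integral>\<^sup>+x. (\<integral>\<^sup>+a. f (x(d := a)) \<partial>lborel) \<partial>lborel_dim d)"
    if "f \<in> borel_measurable (lborel_dim (Suc d))" for f
    using that unfolding ins by (intro product_nn_integral_insert) auto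
  have partial: "(\<lambda>x. \<integral>\<^sup>+a. f (x(d := a)) \<partial>lborel) \<in> borel_measurable (lborel_dim d)"
    if f: "f \<in> borel_measurable (lborel_dim (Suc d))" for f
  proof -
    have "(\<lambda>(x, a). f (x(d := a))) \<in> borel_measurable (lborel_dim d \<Otimes>\<^sub>M lborel)"
      using measurable_compose[OF measurable_add_dim f[unfolded ins]] by (simp add: case_prod_beta')
    then show ?thesis by (rule lborel.borel_measurable_nn_integral)
  qed
  show ?case
    unfolding Suc.prems(1-3)[THEN split]
  proof (rule Suc.IH)
    fix x y assume x: "x \<in> dim_space d" and y: "y \<in> dim_space d"
    let ?z = "\<lambda>i\<in>{..<d}. ?t * x i + ?s * y i"
    have upd: "(\<lambda>a. f (z(d := a))) \<in> borel_measurable borel"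
      if "z \<in> dim_space d" and f: "f \<in> borel_measurable (lborel_dim (Suc d))" for f :: "(nat \<Rightarrow> real) \<Rightarrow> ennreal" and z
      using that measurable_compose[OF measurable_component_update[of z "{..<d}" "\<lambda>_. lborel" d] f[unfolded ins]]
      by (simp add: space_PiM)
    have z: "?z \<in> dim_space d" by simp
    show "(\<integral>\<^sup>+a. u (x(d := a)) \<partial>lborel) ^ m * (\<integral>\<^sup>+a. v (y(d := a)) \<partial>lborel) \<le> (\<integral>\<^sup>+a. w (?z(d := a)) \<partial>lborel) ^ Suc m"
    proof (rule prekopa_leindler_1d[OF _ _ _ m])
      fix a b :: real
      have 1: "x(d := a) \<in> dim_space (Suc d)" "y(d := b) \<in> dim_space (Suc d)"
        using x y by (auto simp: PiE_iff extensional_def)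
      have 2: "(\<lambda>i\<in>{..<Suc d}. ?t * (x(d := a)) i + ?s * (y(d := b)) i) = ?z(d := ?t * a + ?s * b)"
        by (auto simp: fun_eq_iff)
      show "u (x(d := a)) ^ m * v (y(d := b)) \<le> w (?z(d := ?t * a + ?s * b)) ^ Suc m"
        using Suc.prems(4)[OF 1] unfolding 2 .
    qed (fact upd[OF x Suc.prems(1)] upd[OF y Suc.prems(2)] upd[OF z Suc.prems(3)])+
  qed (intro partial Suc.prems(1-3))+
qed

section \<open>Logarithmic Sobolev inequality for strongly log-concave measures\<close>

lemma (in finite_measure) integrable_bounded:
  fixes f :: "'a \<Rightarrow> real"
  assumes "f \<in> borel_measurable M" and "\<And>x. x \<in> space M \<Longrightarrow> \<bar>f x\<bar> \<le> B"
  shows "integrable M f"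
  using assms by (intro integrable_const_bound[of _ B]) auto

definition log_density_measure :: "nat \<Rightarrow> ((nat \<Rightarrow> real) \<Rightarrow> real) \<Rightarrow> (nat \<Rightarrow> real) measure" where
  "log_density_measure d W = density (lborel_dim d) (\<lambda>x. ennreal (exp (- W x)))"

lemma space_log_density_measure [simp]: "space (log_density_measure d W) = dim_space d"
  by (simp add: log_density_measure_def space_PiM)

lemma sets_log_density_measure [measurable_cong]: "sets (log_density_measure d W) = sets (lborel_dim d)"
  by (simp add: log_density_measure_def)

lemma nn_integral_exp_log_density_measure:
  assumes [measurable]: "W \<in> borel_measurable (lborel_dim d)" and "prob_space (log_density_measure d W)"
    and [measurable]: "h \<in> borel_measurable (lborel_dim d)" and h: "\<And>x. x \<in> dim_space d \<Longrightarrow> \<bar>h x\<bar> \<le> B"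
  shows "(\<integral>\<^sup>+x. ennreal (exp (h x - W x)) \<partial>lborel_dim d) = ennreal (\<integral>x. exp (h x) \<partial>log_density_measure d W)"
proof -
  interpret prob_space "log_density_measure d W" by fact
  have "\<bar>exp (h x)\<bar> \<le> exp B" if "x \<in> dim_space d" for x
    using h[OF that] by auto
  then have int: "integrable (log_density_measure d W) (\<lambda>x. exp (h x))"
    by (intro integrable_bounded[of _ "exp B"]) (auto, measurable)
  have "(\<integral>\<^sup>+x. ennreal (exp (h x - W x)) \<partial>lborel_dim d) = (\<integral>\<^sup>+x. ennreal (exp (- W x)) * ennreal (exp (h x)) \<partial>lborel_dim d)"
    by (intro nn_integral_cong) (simp add: exp_diff exp_minus field_simps flip: ennreal_mult)
  also have "\<dots> = (\<integral>\<^sup>+x. ennreal (exp (h x)) \<partial>log_density_measure d W)"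
    unfolding log_density_measure_def by (rule nn_integral_density[symmetric]) measurable
  also have "\<dots> = ennreal (\<integral>x. exp (h x) \<partial>log_density_measure d W)"
    by (rule nn_integral_eq_integral[OF int]) auto
  finally show ?thesis .
qed

text \<open>
  Convexity of \<open>W - |x|\<^sup>2 / 2\<close>, that is, a Hessian bounded below by the identity when \<open>W\<close> is smooth.
\<close>

definition strongly_convex :: "nat \<Rightarrow> ((nat \<Rightarrow> real) \<Rightarrow> real) \<Rightarrow> bool" where
  "strongly_convex d W \<longleftrightarrow> (\<forall>x\<in>dim_space d. \<forall>y\<in>dim_space d. \<forall>t>0. \<forall>s>0. t + s = 1 \<longrightarrow>
     W (\<lambda>i\<in>{..<d}. t * x i + s * y i) + t * s / 2 * (\<Sum>i<d. (x i - y i)\<^sup>2) \<le> t * W x + s * W y)"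

text \<open>
  This is the Prekopa--Leindler inequality for \<open>u = exp ((1 + 1 / m) g - W)\<close>, \<open>v = exp (- W)\<close> and
  \<open>w = exp (g + |p|\<^sup>2 / (2 (m - C)) - W)\<close>. Let \<open>z = t x + s y\<close> with \<open>t = m / (m + 1)\<close>,
  \<open>s = 1 / (m + 1)\<close>, and let \<open>h = x - z = s (x - y)\<close>. Strong convexity contributes
  \<open>- (t s / 2) |x - y|\<^sup>2 = - (m / 2) |h|\<^sup>2\<close>, the expansion of \<open>g\<close> at \<open>z\<close> contributes
  \<open>p z \<bullet> h + (C / 2) |h|\<^sup>2\<close>, and the maximum of \<open>p \<bullet> h - ((m - C) / 2) |h|\<^sup>2\<close> over \<open>h\<close> is the
  additional term in \<open>w\<close>. The vector \<open>p z\<close> stands for the gradient of \<open>g\<close> at \<open>z\<close>.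
\<close>

lemma exponential_prekopa_leindler:
  fixes d :: nat and W g :: "(nat \<Rightarrow> real) \<Rightarrow> real" and p :: "nat \<Rightarrow> (nat \<Rightarrow> real) \<Rightarrow> real"
  defines "M \<equiv> log_density_measure d W"
  assumes [measurable]: "W \<in> borel_measurable (lborel_dim d)" and prob: "prob_space M" and conv: "strongly_convex d W"
    and g [measurable]: "g \<in> borel_measurable (lborel_dim d)" and gB: "\<And>x. x \<in> dim_space d \<Longrightarrow> \<bar>g x\<bar> \<le> B"
    and p [measurable]: "\<And>i. i < d \<Longrightarrow> p i \<in> borel_measurable (lborel_dim d)"
    and pQ: "\<And>x. x \<in> dim_space d \<Longrightarrow> (\<Sum>i<d. (p i x)\<^sup>2) \<le> Q"
    and expand: "\<And>x y. x \<in> dim_space d \<Longrightarrow> y \<in> dim_space d \<Longrightarrow>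
      g y \<le> g x + (\<Sum>i<d. p i x * (y i - x i)) + C / 2 * (\<Sum>i<d. (y i - x i)\<^sup>2)"
    and m: "m > 0" "real m > C"
  shows "(\<integral>x. exp ((1 + 1 / m) * g x) \<partial>M) ^ m \<le> (\<integral>x. exp (g x + (\<Sum>i<d. (p i x)\<^sup>2) / (2 * (m - C))) \<partial>M) ^ Suc m"
proof -
  interpret prob_space M by fact
  let ?t = "real m / real (Suc m)" and ?s = "1 / real (Suc m)"
  let ?P = "\<lambda>x. \<Sum>i<d. (p i x)\<^sup>2"
  have [measurable]: "?P \<in> borel_measurable (lborel_dim d)"
    by (intro borel_measurable_sum borel_measurable_power p) auto
  have PL: "(\<integral>\<^sup>+x. ennreal (exp ((1 + 1 / m) * g x - W x)) \<partial>lborel_dim d) ^ m * (\<integral>\<^sup>+x. ennreal (exp (0 - W x)) \<partial>lborel_dim d)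
    \<le> (\<integral>\<^sup>+x. ennreal (exp ((g x + ?P x / (2 * (m - C))) - W x)) \<partial>lborel_dim d) ^ Suc m"
  proof (rule prekopa_leindler[OF _ _ _ m(1)])
    fix x y assume x: "x \<in> dim_space d" and y: "y \<in> dim_space d"
    define z where "z = (\<lambda>i\<in>{..<d}. ?t * x i + ?s * y i)"
    have z: "z \<in> dim_space d" by (simp add: z_def)
    have ts: "?t + ?s = 1" "?t > 0" "?s > 0" "?t = m * ?s" using m(1) by (auto simp: field_simps)
    have h: "x i - z i = ?s * (x i - y i)" if "i < d" for i
    proof -
      have "a - (t * a + s * b) = s * (a - b)" if "t + s = 1" for a b t s :: real
      proof -
        have "t = 1 - s" using that by simp
        then show ?thesis unfolding \<open>t = 1 - s\<close> by (simp add: algebra_simps)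
      qed
      from this[OF ts(1)] show ?thesis using that by (simp only: z_def restrict_apply lessThan_iff if_True)
    qed
    have D: "(\<Sum>i<d. (x i - z i)\<^sup>2) = ?s\<^sup>2 * (\<Sum>i<d. (x i - y i)\<^sup>2)"
      unfolding sum_distrib_left by (intro sum.cong refl) (simp only: h lessThan_iff power_mult_distrib)
    have young: "p i z * h \<le> (p i z)\<^sup>2 / (2 * (m - C)) + (m - C) / 2 * h\<^sup>2" for i h
    proof -
      have "0 \<le> (p i z - (m - C) * h)\<^sup>2 / (2 * (m - C))" using m by simp
      also have "\<dots> = (p i z)\<^sup>2 / (2 * (m - C)) + (m - C) / 2 * h\<^sup>2 - p i z * h"
        using m by (simp add: power2_eq_square field_simps)
      finally show ?thesis by simp
    qed
    have "g x \<le> g z + (\<Sum>i<d. p i z * (x i - z i)) + C / 2 * (\<Sum>i<d. (x i - z i)\<^sup>2)"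
      by (rule expand[OF z x])
    also have "(\<Sum>i<d. p i z * (x i - z i)) \<le> (\<Sum>i<d. (p i z)\<^sup>2 / (2 * (m - C)) + (m - C) / 2 * (x i - z i)\<^sup>2)"
      by (intro sum_mono young)
    also have "\<dots> = ?P z / (2 * (m - C)) + (m - C) / 2 * (\<Sum>i<d. (x i - z i)\<^sup>2)"
      by (simp add: sum.distrib sum_divide_distrib sum_distrib_left)
    finally have "g x \<le> g z + ?P z / (2 * (m - C)) + m / 2 * (\<Sum>i<d. (x i - z i)\<^sup>2)"
      by (simp add: algebra_simps diff_divide_distrib)
    also have "m / 2 * (\<Sum>i<d. (x i - z i)\<^sup>2) = ?t * ?s / 2 * (\<Sum>i<d. (x i - y i)\<^sup>2)"
    proof -
      have "m / 2 * (s\<^sup>2 * S) = t * s / 2 * S" if "t = m * s" for t s S :: real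
        unfolding that by (simp add: power2_eq_square)
      from this[OF ts(4)] show ?thesis unfolding D .
    qed
    also have "\<dots> \<le> ?t * W x + ?s * W y - W z"
    proof -
      have "W z + ?t * ?s / 2 * (\<Sum>i<d. (x i - y i)\<^sup>2) \<le> ?t * W x + ?s * W y"
        using conv x y ts(1-3) unfolding strongly_convex_def z_def by blast
      then show ?thesis by linarith
    qed
    finally have "g x - ?t * W x - ?s * W y \<le> g z + ?P z / (2 * (m - C)) - W z" by simp
    then have "Suc m * (g x - ?t * W x - ?s * W y) \<le> Suc m * (g z + ?P z / (2 * (m - C)) - W z)"
      by (intro mult_left_mono) auto
    also have "Suc m * (g x - ?t * W x - ?s * W y) = m * ((1 + 1 / m) * g x - W x) + (0 - W y)"
    proof -
      have "Suc m * ?t = m" "Suc m * ?s = 1" by simp_all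
      then have "Suc m * (g x - ?t * W x - ?s * W y) = Suc m * g x - m * W x - W y"
        by (metis (no_types, lifting) mult.assoc mult_1 right_diff_distrib)
      also have "\<dots> = m * ((1 + 1 / m) * g x - W x) + (0 - W y)"
        using m(1) by (simp add: field_simps)
      finally show ?thesis .
    qed
    finally have "exp (m * ((1 + 1 / m) * g x - W x) + (0 - W y)) \<le> exp (Suc m * (g z + ?P z / (2 * (m - C)) - W z))"
      by simp
    then have "exp ((1 + 1 / m) * g x - W x) ^ m * exp (0 - W y) \<le> exp (g z + ?P z / (2 * (m - C)) - W z) ^ Suc m"
      unfolding exp_of_nat_mult exp_add .
    then show "ennreal (exp ((1 + 1 / m) * g x - W x)) ^ m * ennreal (exp (0 - W y))
      \<le> ennreal (exp ((g (\<lambda>i\<in>{..<d}. ?t * x i + ?s * y i) + ?P (\<lambda>i\<in>{..<d}. ?t * x i + ?s * y i) / (2 * (m - C))) - W (\<lambda>i\<in>{..<d}. ?t * x i + ?s * y i))) ^ Suc m"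
      unfolding z_def[symmetric] by (simp add: ennreal_power ennreal_leI flip: ennreal_mult del: power_Suc)
  qed measurable
  have P0: "?P x \<ge> 0" for x by (simp add: sum_nonneg)
  have Pb: "\<bar>g x + ?P x / (2 * (m - C))\<bar> \<le> B + Q / (2 * (m - C))" if "x \<in> dim_space d" for x
  proof -
    have "\<bar>?P x / (2 * (m - C))\<bar> = ?P x / (2 * (m - C))" using m P0 by simp
    also have "\<dots> \<le> Q / (2 * (m - C))" using m pQ[OF that] by (intro divide_right_mono) auto
    finally show ?thesis using gB[OF that] by linarith
  qed
  have gb: "\<bar>(1 + 1 / m) * g x\<bar> \<le> (1 + 1 / m) * B" if "x \<in> dim_space d" for x
    unfolding abs_mult using gB[OF that] by (simp add: mult_left_mono)
  note * = nn_integral_exp_log_density_measure[OF \<open>W \<in> _\<close> prob[unfolded M_def], folded M_def]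
  have "ennreal (\<integral>x. exp ((1 + 1 / m) * g x) \<partial>M) ^ m * ennreal (\<integral>x. exp 0 \<partial>M)
     \<le> ennreal (\<integral>x. exp (g x + ?P x / (2 * (m - C))) \<partial>M) ^ Suc m"
    using PL *[OF _ gb] *[of "\<lambda>_. 0" 0] *[OF _ Pb] by simp
  then have "ennreal ((\<integral>x. exp ((1 + 1 / m) * g x) \<partial>M) ^ m) \<le> ennreal ((\<integral>x. exp (g x + ?P x / (2 * (m - C))) \<partial>M) ^ Suc m)"
    by (simp add: ennreal_power prob_space del: power_Suc)
  then show ?thesis
    by (subst (asm) ennreal_le_iff) (auto simp del: power_Suc intro!: zero_le_power)
qed

text \<open>
  Both sides of \<open>exponential_prekopa_leindler\<close> are, after taking logarithms, expanded to first
  order in \<open>1 / m\<close>. Write \<open>A\<close>, \<open>E\<close>, \<open>R\<close> for the integrals of \<open>exp g\<close>, \<open>g exp g\<close>, \<open>|p|\<^sup>2 exp g\<close>. The left side is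
  \<open>m ln A + E / A + o(1)\<close>, the right side is \<open>(m + 1) ln A + R / (2 A) + o(1)\<close>, so in the limit
  \<open>E - A ln A \<le> R / 2\<close>, where the left side is the entropy.
\<close>

lemma log_sobolev_strongly_convex_exp:
  fixes d :: nat and W g :: "(nat \<Rightarrow> real) \<Rightarrow> real" and p :: "nat \<Rightarrow> (nat \<Rightarrow> real) \<Rightarrow> real"
  defines "M \<equiv> log_density_measure d W"
  assumes W [measurable]: "W \<in> borel_measurable (lborel_dim d)" and prob: "prob_space M" and conv: "strongly_convex d W"
    and g [measurable]: "g \<in> borel_measurable (lborel_dim d)" and gB: "\<And>x. x \<in> dim_space d \<Longrightarrow> \<bar>g x\<bar> \<le> B"
    and p [measurable]: "\<And>i. i < d \<Longrightarrow> p i \<in> borel_measurable (lborel_dim d)"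
    and pQ: "\<And>x. x \<in> dim_space d \<Longrightarrow> (\<Sum>i<d. (p i x)\<^sup>2) \<le> Q"
    and expand: "\<And>x y. x \<in> dim_space d \<Longrightarrow> y \<in> dim_space d \<Longrightarrow>
      g y \<le> g x + (\<Sum>i<d. p i x * (y i - x i)) + C / 2 * (\<Sum>i<d. (y i - x i)\<^sup>2)"
  shows "Ent M (\<lambda>x. exp (g x)) \<le> 1 / 2 * (\<integral>x. (\<Sum>i<d. (p i x)\<^sup>2) * exp (g x) \<partial>M)"
proof -
  interpret prob_space M by fact
  let ?P = "\<lambda>x. \<Sum>i<d. (p i x)\<^sup>2"
  have sp: "space M = dim_space d" by (simp add: M_def)
  have [measurable_cong]: "sets M = sets (lborel_dim d)" by (simp add: M_def sets_log_density_measure)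
  have [measurable]: "?P \<in> borel_measurable (lborel_dim d)"
    by (intro borel_measurable_sum borel_measurable_power p) auto
  have P0: "?P x \<ge> 0" for x by (simp add: sum_nonneg)
  have gB': "g x \<le> B" "\<bar>g x\<bar> \<le> \<bar>B\<bar>" if "x \<in> space M" for x
    using gB[of x] that sp by auto
  have Q0: "Q \<ge> 0" using not_empty pQ P0 unfolding sp by (meson order_trans ex_in_conv)
  have int_exp: "integrable M (\<lambda>x. exp (c * g x))" for c
  proof (rule integrable_bounded)
    fix x assume "x \<in> space M"
    have "c * g x \<le> \<bar>c\<bar> * \<bar>B\<bar>"
      using gB'[OF \<open>x \<in> space M\<close>] abs_mult[of c "g x"] mult_left_mono[of "\<bar>g x\<bar>" "\<bar>B\<bar>" "\<bar>c\<bar>"] by linarith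
    then show "\<bar>exp (c * g x)\<bar> \<le> exp (\<bar>c\<bar> * \<bar>B\<bar>)" by simp
  qed measurable
  have int_g: "integrable M (\<lambda>x. g x * exp (g x))"
    by (rule integrable_bounded[of _ "\<bar>B\<bar> * exp B"]) (use gB' in \<open>auto simp: abs_mult intro!: mult_mono\<close>)
  have int_P: "integrable M (\<lambda>x. ?P x * exp (g x))"
    by (rule integrable_bounded[of _ "Q * exp B"]) (use gB' pQ P0 sp Q0 in \<open>auto simp: abs_mult intro!: mult_mono\<close>)
  define A where "A = (\<integral>x. exp (g x) \<partial>M)"
  define E where "E = (\<integral>x. g x * exp (g x) \<partial>M)"
  define R where "R = (\<integral>x. ?P x * exp (g x) \<partial>M)"
  have A: "A > 0"
  proof -
    have "exp (- \<bar>B\<bar>) = (\<integral>x. exp (- \<bar>B\<bar>) \<partial>M)" by (simp add: prob_space)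
    also have "\<dots> \<le> A"
      unfolding A_def using int_exp[of 1] gB' by (intro integral_mono) force+
    finally show ?thesis by (smt (verit) exp_gt_zero)
  qed
  have R: "R \<ge> 0" unfolding R_def using P0 by (intro integral_nonneg_AE) auto
  \<comment> \<open>Beyond this threshold \<open>m > C\<close>, the exponent \<open>|p|\<^sup>2 / (2 (m - C))\<close> is at most one, so that
    \<open>exp_bound\<close> applies, and \<open>1 + E / (A m)\<close> is positive.\<close>
  define N where "N = nat \<lceil>max (max C 0 + Q + 1) (- E / A + 1)\<rceil> + 1"
  have bound: "m * ln (1 + (E / A) / m) \<le> ln A + (m + 1) * (R / A / (2 * (m - C)) + (Q / (2 * (m - C)))\<^sup>2)"
    if "m \<ge> N" for m :: nat
  proof -
    have mN: "real m \<ge> max C 0 + Q + 1" "real m \<ge> - E / A + 1" using that unfolding N_def by linarith+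
    then have m: "real m > C" "m > 0" "real m - C \<ge> Q" "Q / (2 * (m - C)) \<le> 1" "real m - C > 0"
      using Q0 by (auto simp: field_simps)
    have lower: "A + E / m \<le> (\<integral>x. exp ((1 + 1 / m) * g x) \<partial>M)"
    proof -
      have "A + E / m = (\<integral>x. exp (g x) + g x * exp (g x) / m \<partial>M)"
        unfolding A_def E_def using int_exp[of 1] int_g by simp
      also have "\<dots> \<le> (\<integral>x. exp ((1 + 1 / m) * g x) \<partial>M)"
      proof (rule integral_mono)
        show "integrable M (\<lambda>x. exp (g x) + g x * exp (g x) / m)" using int_exp[of 1] int_g by simp
        show "integrable M (\<lambda>x. exp ((1 + 1 / m) * g x))" by (rule int_exp)
        fix x
        have "exp (g x) * (1 + g x / m) \<le> exp (g x) * exp (g x / m)"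
          by (intro mult_left_mono exp_ge_add_one_self) auto
        then show "exp (g x) + g x * exp (g x) / m \<le> exp ((1 + 1 / m) * g x)"
          by (simp add: algebra_simps exp_add)
      qed
      finally show ?thesis .
    qed
    have upper: "(\<integral>x. exp (g x + ?P x / (2 * (m - C))) \<partial>M) \<le> A + R / (2 * (m - C)) + (Q / (2 * (m - C)))\<^sup>2 * A"
    proof -
      have pt: "exp (g x + ?P x / (2 * (m - C))) \<le> exp (g x) + ?P x * exp (g x) / (2 * (m - C)) + (Q / (2 * (m - C)))\<^sup>2 * exp (g x)"
        if "x \<in> space M" for x
      proof -
        have le: "?P x / (2 * (m - C)) \<le> Q / (2 * (m - C))"
          using pQ[of x] that m unfolding sp by (intro divide_right_mono) auto
        have ge: "?P x / (2 * (m - C)) \<ge> 0" using P0 m by (intro divide_nonneg_nonneg) auto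
        have "exp (?P x / (2 * (m - C))) \<le> 1 + ?P x / (2 * (m - C)) + (?P x / (2 * (m - C)))\<^sup>2"
          using le ge m(4) by (intro exp_bound) auto
        also have "(?P x / (2 * (m - C)))\<^sup>2 \<le> (Q / (2 * (m - C)))\<^sup>2"
          using le ge by (rule power_mono)
        finally have "exp (g x) * exp (?P x / (2 * (m - C))) \<le> exp (g x) * (1 + ?P x / (2 * (m - C)) + (Q / (2 * (m - C)))\<^sup>2)"
          by (intro mult_left_mono) auto
        then show ?thesis by (simp add: exp_add algebra_simps)
      qed
      have "(\<integral>x. exp (g x + ?P x / (2 * (m - C))) \<partial>M)
         \<le> (\<integral>x. exp (g x) + ?P x * exp (g x) / (2 * (m - C)) + (Q / (2 * (m - C)))\<^sup>2 * exp (g x) \<partial>M)"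
      proof (rule integral_mono_AE')
        show "integrable M (\<lambda>x. exp (g x) + ?P x * exp (g x) / (2 * (m - C)) + (Q / (2 * (m - C)))\<^sup>2 * exp (g x))"
          using int_exp[of 1] int_P by simp
        show "AE x in M. exp (g x + ?P x / (2 * (m - C))) \<le> exp (g x) + ?P x * exp (g x) / (2 * (m - C)) + (Q / (2 * (m - C)))\<^sup>2 * exp (g x)"
          using pt by (rule AE_I2)
        show "AE x in M. 0 \<le> exp (g x) + ?P x * exp (g x) / (2 * (m - C)) + (Q / (2 * (m - C)))\<^sup>2 * exp (g x)"
          using P0 m by (intro AE_I2 add_nonneg_nonneg divide_nonneg_nonneg mult_nonneg_nonneg) auto
      qed
      also have "\<dots> = A + R / (2 * (m - C)) + (Q / (2 * (m - C)))\<^sup>2 * A"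
        unfolding A_def R_def using int_exp[of 1] int_P by simp
      finally show ?thesis .
    qed
    have E1: "1 + E / A / m > 0"
    proof -
      have "- E / A < m" using mN(2) by linarith
      then show ?thesis using m A by (simp add: field_simps)
    qed
    have AE: "A + E / m = A * (1 + E / A / m)" using A m by (simp add: field_simps)
    define Z where "Z = R / A / (2 * (m - C)) + (Q / (2 * (m - C)))\<^sup>2"
    have Z: "Z \<ge> 0" unfolding Z_def using R A m by (intro add_nonneg_nonneg divide_nonneg_nonneg) auto
    have AZ: "A + R / (2 * (m - C)) + (Q / (2 * (m - C)))\<^sup>2 * A = A * (1 + Z)"
      unfolding Z_def using A by (simp add: distrib_left mult.commute)
    have "(A * (1 + E / A / m)) ^ m \<le> (\<integral>x. exp ((1 + 1 / m) * g x) \<partial>M) ^ m"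
      using lower AE A E1 by (intro power_mono) auto
    also have "\<dots> \<le> (\<integral>x. exp (g x + ?P x / (2 * (m - C))) \<partial>M) ^ Suc m"
      unfolding M_def by (rule exponential_prekopa_leindler[OF W prob[unfolded M_def] conv g gB p pQ expand m(2,1)]) auto
    also have "\<dots> \<le> (A * (1 + Z)) ^ Suc m"
      using upper AZ by (intro power_mono) auto
    finally have "ln ((A * (1 + E / A / m)) ^ m) \<le> ln ((A * (1 + Z)) ^ Suc m)"
      using A E1 Z by (subst ln_le_cancel_iff) auto
    then have "m * (ln A + ln (1 + E / A / m)) \<le> (m + 1) * (ln A + ln (1 + Z))"
      using A E1 Z by (simp add: ln_realpow ln_mult del: power_Suc)
    moreover have "(m + 1) * ln (1 + Z) \<le> (m + 1) * Z"
      using Z ln_add_one_self_le_self by (intro mult_left_mono) auto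
    ultimately show ?thesis unfolding Z_def by (simp add: algebra_simps)
  qed
  have lim1: "(\<lambda>m. real m * ln (1 + (E / A) / m)) \<longlonglongrightarrow> E / A"
  proof -
    have "(\<lambda>m. real m * ln (1 + a / m)) \<longlonglongrightarrow> a" for a :: real
    proof (cases a "0 :: real" rule: linorder_cases)
      case less then show ?thesis by real_asymp
    next
      case equal then show ?thesis by simp
    next
      case greater then show ?thesis by real_asymp
    qed
    then show ?thesis .
  qed
  have lim2: "(\<lambda>m. ln A + (real m + 1) * (R / A / (2 * (real m - C)) + (Q / (2 * (real m - C)))\<^sup>2)) \<longlonglongrightarrow> ln A + R / A / 2"
  proof -
    have l1: "(\<lambda>m. (real m + 1) / (2 * (real m - C))) \<longlonglongrightarrow> 1 / 2" by real_asymp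
    have l2: "(\<lambda>m. (real m + 1) * (1 / (2 * (real m - C)))\<^sup>2) \<longlonglongrightarrow> 0" by real_asymp
    have "(\<lambda>m. ln A + (R / A * ((real m + 1) / (2 * (real m - C))) + Q\<^sup>2 * ((real m + 1) * (1 / (2 * (real m - C)))\<^sup>2)))
      \<longlonglongrightarrow> ln A + (R / A * (1 / 2) + Q\<^sup>2 * 0)"
      by (intro tendsto_intros l1 l2)
    moreover have "x + (a * (n / k) + q\<^sup>2 * (n * (1 / k)\<^sup>2)) = x + n * (a / k + (q / k)\<^sup>2)" for x a n k q :: real
      by (simp add: distrib_left power_divide mult.commute)
    ultimately show ?thesis by (simp only: mult_zero_right add_0_right times_divide_eq_right mult_1_right)
  qed
  have "E / A \<le> ln A + R / A / 2"
    using bound by (intro LIMSEQ_le[OF lim1 lim2]) (auto simp: add.commute)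
  then have "E \<le> A * ln A + R / 2" using A by (simp add: field_simps)
  then show ?thesis unfolding Ent_def A_def E_def R_def by (simp add: mult.commute)
qed

section \<open>Quadratic expansion of compactly supported functions\<close>

lemma fun_upd_in_dim_space: "x \<in> dim_space d \<Longrightarrow> i < d \<Longrightarrow> x(i := t) \<in> dim_space d"
  by (auto simp: PiE_iff extensional_def)

lemma closed_dim_space: "closed (dim_space d)"
proof -
  have "closed {x :: nat \<Rightarrow> real. x i = undefined}" for i
    by (intro closed_Collect_eq continuous_on_const continuous_on_product_coordinates)
  then have "closed (\<Inter>i\<in>{d..}. {x :: nat \<Rightarrow> real. x i = undefined})"
    by (intro closed_INT ballI)
  also have "(\<Inter>i\<in>{d..}. {x :: nat \<Rightarrow> real. x i = undefined}) = dim_space d"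
    by (rule set_eqI) (simp only: INT_iff PiE_iff extensional_def mem_Collect_eq UNIV_I atLeast_iff lessThan_iff not_less Ball_def, simp)
  finally show ?thesis .
qed

text \<open>
  Continuity refers to the topology of \<open>nat \<Rightarrow> real\<close>, measurability to the product over \<open>{..<d}\<close>.
  The inclusion of the second space into the first is measurable because the coordinates beyond \<open>d\<close>
  are constant.
\<close>

lemma borel_measurable_continuous_on_dim_space:
  fixes f :: "(nat \<Rightarrow> real) \<Rightarrow> real"
  assumes "continuous_on (dim_space d) f"
  shows "f \<in> borel_measurable (lborel_dim d)"
proof -
  have id: "(\<lambda>x. x) \<in> measurable (lborel_dim d) (Pi\<^sub>M UNIV (\<lambda>_. borel))"
  proof (rule measurable_PiM_single')
    fix i :: nat
    show "(\<lambda>x. x i) \<in> borel_measurable (lborel_dim d)"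
    proof (cases "i < d")
      case False
      have "(\<lambda>x. undefined) \<in> borel_measurable (lborel_dim d)" by simp
      then show ?thesis
        by (rule measurable_cong[THEN iffD1, rotated]) (use False in \<open>simp add: space_PiM PiE_iff extensional_def\<close>)
    qed (use measurable_component_singleton[of i "{..<d}" "\<lambda>_. lborel"] in simp)
  qed (simp add: PiE_UNIV_domain)
  then have "(\<lambda>x. x) \<in> measurable (lborel_dim d) (borel :: (nat \<Rightarrow> real) measure)"
    by (simp add: measurable_cong_sets[OF refl sets_PiM_equal_borel])
  then have "(\<lambda>x. x) \<in> measurable (lborel_dim d) (restrict_space borel (dim_space d))"
    by (intro measurable_restrict_space2) (auto simp: space_PiM)
  then show ?thesis
    using borel_measurable_continuous_on_restrict[OF assms] by (rule measurable_compose)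
qed

definition partially_differentiable :: "nat \<Rightarrow> ((nat \<Rightarrow> real) \<Rightarrow> real) \<Rightarrow> bool" where
  "partially_differentiable d f \<longleftrightarrow>
    (\<forall>i<d. \<forall>x\<in>dim_space d. (\<lambda>t. f (x(i := t))) field_differentiable at (x i))"

lemma coordinate_has_derivative:
  assumes "partially_differentiable d f" "x \<in> dim_space d" "i < d"
  shows "((\<lambda>t. f (x(i := t))) has_real_derivative partial_deriv i f (x(i := a))) (at a)"
proof -
  have "(\<lambda>t. f ((x(i := a))(i := t))) field_differentiable at ((x(i := a)) i)"
    using assms fun_upd_in_dim_space[OF assms(2,3)] unfolding partially_differentiable_def by blast
  then show ?thesis by (simp add: partial_deriv_def DERIV_deriv_iff_field_differentiable)
qed

lemma mean_value_unordered:
  fixes \<phi> :: "real \<Rightarrow> real"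
  assumes "\<And>t. (\<phi> has_real_derivative \<phi>' t) (at t)"
  obtains c where "\<bar>c - a\<bar> \<le> \<bar>b - a\<bar>" "\<phi> b - \<phi> a = \<phi>' c * (b - a)"
proof (cases a b rule: linorder_cases)
  case less
  then obtain c where "a < c" "c < b" "\<phi> b - \<phi> a = (b - a) * \<phi>' c"
    using MVT2[of a b \<phi> \<phi>'] assms by blast
  then show ?thesis using that[of c] by (auto simp: mult.commute)
next
  case equal then show ?thesis using that[of a] by auto
next
  case greater
  then obtain c where "b < c" "c < a" "\<phi> a - \<phi> b = (a - b) * \<phi>' c"
    using MVT2[of b a \<phi> \<phi>'] assms by blast
  then show ?thesis using that[of c] by (auto simp: algebra_simps)
qed

text \<open>
  Moving from \<open>x\<close> to \<open>y\<close> one coordinate at a time, the one-dimensional mean value theorem on each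
  segment gives a first-order expansion directly from the partial derivatives, without passing
  through total differentiability.
\<close>

lemma coordinatewise_mean_value:
  assumes f: "partially_differentiable d f" and x: "x \<in> dim_space d" and y: "y \<in> dim_space d"
  shows "\<exists>\<xi>. (\<forall>i<d. \<xi> i \<in> dim_space d) \<and> (\<forall>i<d. \<forall>j. \<bar>\<xi> i j - x j\<bar> \<le> \<bar>y j - x j\<bar>) \<and>
    f y - f x = (\<Sum>i<d. partial_deriv i f (\<xi> i) * (y i - x i))"
proof -
  define z where "z k = (\<lambda>j. if j < k then y j else x j)" for k
  have z: "z k \<in> dim_space d" if "k \<le> d" for k
    using x y that by (auto simp: z_def PiE_iff extensional_def)
  have upd: "(z k)(k := x k) = z k" "(z k)(k := y k) = z (Suc k)" for k
    by (auto simp: z_def fun_eq_iff less_Suc_eq)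
  have "\<exists>c. \<bar>c - x k\<bar> \<le> \<bar>y k - x k\<bar> \<and> f (z (Suc k)) - f (z k) = partial_deriv k f ((z k)(k := c)) * (y k - x k)"
    if "k < d" for k
    using mean_value_unordered[OF coordinate_has_derivative[OF f z[of k] that], where a = "x k" and b = "y k"] that
    by (auto simp: upd)
  then obtain c where c: "\<And>k. k < d \<Longrightarrow> \<bar>c k - x k\<bar> \<le> \<bar>y k - x k\<bar>"
     "\<And>k. k < d \<Longrightarrow> f (z (Suc k)) - f (z k) = partial_deriv k f ((z k)(k := c k)) * (y k - x k)"
    by metis
  show ?thesis
  proof (intro exI[of _ "\<lambda>i. (z i)(i := c i)"] conjI allI impI)
    show "(z i)(i := c i) \<in> dim_space d" if "i < d" for i
      using that z by (intro fun_upd_in_dim_space) auto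
    show "\<bar>((z i)(i := c i)) j - x j\<bar> \<le> \<bar>y j - x j\<bar>" if "i < d" for i j
      using c(1)[OF that] by (auto simp: z_def)
    have ends: "z 0 = x" "z d = y"
      using x y by (auto simp: z_def fun_eq_iff PiE_iff extensional_def)
    have "(\<Sum>k<d. f (z (Suc k)) - f (z k)) = f y - f x"
      using sum_lessThan_telescope[of "\<lambda>k. f (z k)" d] unfolding ends .
    moreover have "(\<Sum>k<d. f (z (Suc k)) - f (z k)) = (\<Sum>i<d. partial_deriv i f ((z i)(i := c i)) * (y i - x i))"
      by (rule sum.cong[OF refl]) (rule c(2), simp)
    ultimately show "f y - f x = (\<Sum>i<d. partial_deriv i f ((z i)(i := c i)) * (y i - x i))" by (rule subst)
  qed
qed

lemma lipschitz_of_bounded_partial_derivs: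
  assumes f: "partially_differentiable d f" and K: "\<And>i x. i < d \<Longrightarrow> x \<in> dim_space d \<Longrightarrow> \<bar>partial_deriv i f x\<bar> \<le> K"
    and x: "x \<in> dim_space d" and y: "y \<in> dim_space d"
  shows "\<bar>f y - f x\<bar> \<le> K * (\<Sum>i<d. \<bar>y i - x i\<bar>)"
proof -
  obtain \<xi> where \<xi>: "\<And>i. i < d \<Longrightarrow> \<xi> i \<in> dim_space d"
    "\<And>i j. i < d \<Longrightarrow> \<bar>\<xi> i j - x j\<bar> \<le> \<bar>y j - x j\<bar>"
    "f y - f x = (\<Sum>i<d. partial_deriv i f (\<xi> i) * (y i - x i))"
    using coordinatewise_mean_value[OF f x y] by blast
  have "\<bar>f y - f x\<bar> \<le> (\<Sum>i<d. \<bar>partial_deriv i f (\<xi> i) * (y i - x i)\<bar>)"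
    unfolding \<xi>(3) by (rule sum_abs)
  also have "\<dots> \<le> (\<Sum>i<d. K * \<bar>y i - x i\<bar>)"
    using K \<xi>(1) by (intro sum_mono) (auto simp: abs_mult intro!: mult_right_mono)
  finally show ?thesis by (simp add: sum_distrib_left)
qed

lemma first_order_taylor_bound:
  assumes f: "partially_differentiable d f"
    and f': "\<And>i. i < d \<Longrightarrow> partially_differentiable d (partial_deriv i f)"
    and K: "\<And>i j x. i < d \<Longrightarrow> j < d \<Longrightarrow> x \<in> dim_space d \<Longrightarrow> \<bar>partial_deriv j (partial_deriv i f) x\<bar> \<le> K"
    and x: "x \<in> dim_space d" and y: "y \<in> dim_space d"
  shows "\<bar>f y - f x - (\<Sum>i<d. partial_deriv i f x * (y i - x i))\<bar> \<le> K * (\<Sum>i<d. \<bar>y i - x i\<bar>)\<^sup>2"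
proof (cases "d = 0")
  case True
  then have "x = y" using x y by auto
  then show ?thesis using True by simp
next
  case False
  let ?S = "\<Sum>i<d. \<bar>y i - x i\<bar>"
  have K0: "K \<ge> 0" using K[of 0 0 x] False x by (smt (verit) gr0I)
  obtain \<xi> where \<xi>: "\<And>i. i < d \<Longrightarrow> \<xi> i \<in> dim_space d"
    "\<And>i j. i < d \<Longrightarrow> \<bar>\<xi> i j - x j\<bar> \<le> \<bar>y j - x j\<bar>"
    "f y - f x = (\<Sum>i<d. partial_deriv i f (\<xi> i) * (y i - x i))"
    using coordinatewise_mean_value[OF f x y] by blast
  have lip: "\<bar>partial_deriv i f (\<xi> i) - partial_deriv i f x\<bar> \<le> K * ?S" if "i < d" for i
  proof -
    have "\<bar>partial_deriv i f (\<xi> i) - partial_deriv i f x\<bar> \<le> K * (\<Sum>j<d. \<bar>\<xi> i j - x j\<bar>)"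
      using that by (intro lipschitz_of_bounded_partial_derivs f' K x \<xi>(1)) auto
    also have "\<dots> \<le> K * ?S" using that K0 \<xi>(2) by (intro mult_left_mono sum_mono) auto
    finally show ?thesis .
  qed
  have "\<bar>f y - f x - (\<Sum>i<d. partial_deriv i f x * (y i - x i))\<bar>
     = \<bar>\<Sum>i<d. (partial_deriv i f (\<xi> i) - partial_deriv i f x) * (y i - x i)\<bar>"
    unfolding \<xi>(3) by (simp only: left_diff_distrib sum_subtractf)
  also have "\<dots> \<le> (\<Sum>i<d. \<bar>(partial_deriv i f (\<xi> i) - partial_deriv i f x) * (y i - x i)\<bar>)"
    by (rule sum_abs)
  also have "\<dots> \<le> (\<Sum>i<d. K * ?S * \<bar>y i - x i\<bar>)"
    using lip by (intro sum_mono) (auto simp: abs_mult intro!: mult_right_mono)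
  also have "\<dots> = K * ?S\<^sup>2" unfolding sum_distrib_left[symmetric] power2_eq_square by (rule mult.assoc)
  finally show ?thesis .
qed

lemma partial_deriv_eq_0_outside:
  assumes "closed K" and f: "\<And>x. x \<in> dim_space d \<Longrightarrow> x \<notin> K \<Longrightarrow> f x = 0"
    and "i < d" "x \<in> dim_space d" "x \<notin> K"
  shows "partial_deriv i f x = 0"
proof -
  have "continuous_on UNIV (\<lambda>t. x(i := t))"
  proof (rule continuous_on_coordinatewise_then_product)
    show "continuous_on UNIV (\<lambda>t. (x(i := t)) j)" for j by (cases "j = i") simp_all
  qed
  then have "open ((\<lambda>t. x(i := t)) -` (- K))"
    using assms(1) by (intro open_vimage) auto
  then have "eventually (\<lambda>t. t \<in> (\<lambda>t. x(i := t)) -` (- K)) (nhds (x i))"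
    using assms by (intro eventually_nhds_in_open) auto
  then have "eventually (\<lambda>t. f (x(i := t)) = 0) (nhds (x i))"
    by eventually_elim (use f fun_upd_in_dim_space[OF assms(4,3)] in auto)
  then have "deriv (\<lambda>t. f (x(i := t))) (x i) = deriv (\<lambda>_. 0) (x i)"
    by (intro deriv_cong_ev) auto
  then show ?thesis by (simp add: partial_deriv_def)
qed

lemma bounded_if_continuous_compact_support:
  fixes f :: "(nat \<Rightarrow> real) \<Rightarrow> real"
  assumes "compact K" "K \<subseteq> dim_space d" "continuous_on (dim_space d) f"
    and f: "\<And>x. x \<in> dim_space d \<Longrightarrow> x \<notin> K \<Longrightarrow> f x = 0"
  shows "\<exists>B. \<forall>x\<in>dim_space d. \<bar>f x\<bar> \<le> B"
proof -
  have "compact (f ` K)" using assms by (intro compact_continuous_image) (auto intro: continuous_on_subset)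
  then have "bounded (f ` K)" by (rule compact_imp_bounded)
  then obtain B where B: "\<And>x. x \<in> K \<Longrightarrow> \<bar>f x\<bar> \<le> B" "B > 0" by (auto simp: bounded_pos)
  then have "\<bar>f x\<bar> \<le> B" if "x \<in> dim_space d" for x using f[OF that] by (cases "x \<in> K") auto
  then show ?thesis by blast
qed

lemma Cc_infinity_bounds:
  assumes "f \<in> Cc_infinity d"
  shows "\<exists>B>0. \<forall>x\<in>dim_space d. \<bar>f x\<bar> \<le> B \<and>
    (\<forall>i<d. \<bar>partial_deriv i f x\<bar> \<le> B \<and> (\<forall>j<d. \<bar>partial_deriv j (partial_deriv i f) x\<bar> \<le> B))"
proof -
  let ?S = "{x \<in> dim_space d. f x \<noteq> 0}"
  define K where "K = closure ?S"
  have C2: "C_k d (Suc (Suc 0)) f" and K: "compact K" "closed K" using assms unfolding Cc_infinity_def K_def by blast+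
  have sub: "K \<subseteq> dim_space d" unfolding K_def by (intro closure_minimal closed_dim_space) auto
  have cont: "continuous_on (dim_space d) f" "\<And>i. i < d \<Longrightarrow> continuous_on (dim_space d) (partial_deriv i f)"
    "\<And>i j. i < d \<Longrightarrow> j < d \<Longrightarrow> continuous_on (dim_space d) (partial_deriv j (partial_deriv i f))"
    using C2 by auto
  have v0: "f x = 0" if "x \<in> dim_space d" "x \<notin> K" for x
    using that closure_subset[of ?S] unfolding K_def by blast
  have v1: "partial_deriv i f x = 0" if "x \<in> dim_space d" "x \<notin> K" "i < d" for i x
    using K(2) v0 that(3,1,2) by (rule partial_deriv_eq_0_outside)
  have v2: "partial_deriv j (partial_deriv i f) x = 0" if "x \<in> dim_space d" "x \<notin> K" "i < d" "j < d" for i j x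
    using K(2) v1[OF _ _ that(3)] that(4,1,2) by (rule partial_deriv_eq_0_outside)
  obtain B0 where B0: "\<And>x. x \<in> dim_space d \<Longrightarrow> \<bar>f x\<bar> \<le> B0"
    using bounded_if_continuous_compact_support[OF K(1) sub cont(1) v0] by metis
  have "\<exists>B. \<forall>x\<in>dim_space d. \<bar>partial_deriv i f x\<bar> \<le> B" if "i < d" for i
    using that by (intro bounded_if_continuous_compact_support[OF K(1) sub] cont(2) v1)
  then obtain B1 where B1: "\<And>i x. i < d \<Longrightarrow> x \<in> dim_space d \<Longrightarrow> \<bar>partial_deriv i f x\<bar> \<le> B1 i" by metis
  have "\<exists>B. \<forall>x\<in>dim_space d. \<bar>partial_deriv j (partial_deriv i f) x\<bar> \<le> B" if "i < d" "j < d" for i j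
    using that by (intro bounded_if_continuous_compact_support[OF K(1) sub] cont(3) v2)
  then obtain B2 where B2: "\<And>i j x. i < d \<Longrightarrow> j < d \<Longrightarrow> x \<in> dim_space d \<Longrightarrow> \<bar>partial_deriv j (partial_deriv i f) x\<bar> \<le> B2 i j" by metis
  define B where "B = \<bar>B0\<bar> + (\<Sum>i<d. \<bar>B1 i\<bar>) + (\<Sum>i<d. \<Sum>j<d. \<bar>B2 i j\<bar>) + 1"
  have s: "(\<Sum>i<d. \<bar>B1 i\<bar>) \<ge> 0" "(\<Sum>i<d. \<Sum>j<d. \<bar>B2 i j\<bar>) \<ge> 0" by (auto intro!: sum_nonneg)
  have l1: "\<bar>B1 i\<bar> \<le> (\<Sum>i<d. \<bar>B1 i\<bar>)" if "i < d" for i using that by (intro member_le_sum) auto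
  have l2: "\<bar>B2 i j\<bar> \<le> (\<Sum>i<d. \<Sum>j<d. \<bar>B2 i j\<bar>)" if "i < d" "j < d" for i j
  proof -
    have "\<bar>B2 i j\<bar> \<le> (\<Sum>j<d. \<bar>B2 i j\<bar>)" using that by (intro member_le_sum) auto
    also have "\<dots> \<le> (\<Sum>i<d. \<Sum>j<d. \<bar>B2 i j\<bar>)"
      using that by (intro member_le_sum[of i "{..<d}" "\<lambda>i. \<Sum>j<d. \<bar>B2 i j\<bar>"]) (auto intro: sum_nonneg)
    finally show ?thesis .
  qed
  show ?thesis
  proof (intro exI[of _ B] conjI ballI allI impI)
    show "B > 0" unfolding B_def using s by linarith
    show "\<bar>f x\<bar> \<le> B" if "x \<in> dim_space d" for x using B0[OF that] s unfolding B_def by linarith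
    show "\<bar>partial_deriv i f x\<bar> \<le> B" if "i < d" "x \<in> dim_space d" for i x
      using B1[OF that] l1[OF that(1)] s unfolding B_def by linarith
    show "\<bar>partial_deriv j (partial_deriv i f) x\<bar> \<le> B" if "i < d" "j < d" "x \<in> dim_space d" for i j x
      using B2[OF that] l2[OF that(1,2)] s unfolding B_def by linarith
  qed
qed

text \<open>
  Concavity of the logarithm reduces the expansion of \<open>ln (f\<^sup>2 + \<epsilon>)\<close> to that of \<open>f\<^sup>2\<close>, and
  \<open>(f y)\<^sup>2 - (f x)\<^sup>2 = 2 f x a + a\<^sup>2\<close>, where \<open>a = f y - f x\<close> is linear up to a quadratic
  error and \<open>a\<^sup>2\<close> is itself quadratic. The constant may depend on \<open>f\<close>, \<open>\<epsilon>\<close> and \<open>d\<close>: it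
  disappears in the limit \<open>m \<rightarrow> \<infinity>\<close> of \<open>log_sobolev_strongly_convex_exp\<close>.
\<close>

lemma log_square_semiconcave:
  assumes f: "f \<in> Cc_infinity d" and \<epsilon>: "\<epsilon> > 0"
  shows "\<exists>C. \<forall>x\<in>dim_space d. \<forall>y\<in>dim_space d.
    ln ((f y)\<^sup>2 + \<epsilon>) \<le> ln ((f x)\<^sup>2 + \<epsilon>) + (\<Sum>i<d. 2 * f x * partial_deriv i f x / ((f x)\<^sup>2 + \<epsilon>) * (y i - x i))
      + C / 2 * (\<Sum>i<d. (y i - x i)\<^sup>2)"
proof -
  obtain B where B: "B > 0" "\<And>x. x \<in> dim_space d \<Longrightarrow> \<bar>f x\<bar> \<le> B"
    "\<And>i x. i < d \<Longrightarrow> x \<in> dim_space d \<Longrightarrow> \<bar>partial_deriv i f x\<bar> \<le> B"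
    "\<And>i j x. i < d \<Longrightarrow> j < d \<Longrightarrow> x \<in> dim_space d \<Longrightarrow> \<bar>partial_deriv j (partial_deriv i f) x\<bar> \<le> B"
    using Cc_infinity_bounds[OF f] by blast
  have C2: "C_k d (Suc (Suc 0)) f" using f unfolding Cc_infinity_def by blast
  have d1: "partially_differentiable d f" and d2: "\<And>i. i < d \<Longrightarrow> partially_differentiable d (partial_deriv i f)"
    using C2 by (auto simp: partially_differentiable_def)
  show ?thesis
  proof (intro exI ballI)
    fix x y assume x: "x \<in> dim_space d" and y: "y \<in> dim_space d"
    define S where "S = (\<Sum>i<d. \<bar>y i - x i\<bar>)"
    define L where "L = (\<Sum>i<d. partial_deriv i f x * (y i - x i))"
    define D where "D = (\<Sum>i<d. (y i - x i)\<^sup>2)"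
    define F where "F = (f x)\<^sup>2 + \<epsilon>"
    have F: "F > 0" "F \<ge> \<epsilon>" using \<epsilon> by (auto simp: F_def add_nonneg_pos)
    define a where "a = f y - f x"
    have a1: "\<bar>a\<bar> \<le> B * S"
      unfolding a_def S_def by (rule lipschitz_of_bounded_partial_derivs[OF d1 B(3) x y])
    have a2: "\<bar>a - L\<bar> \<le> B * S\<^sup>2"
      unfolding a_def S_def L_def by (rule first_order_taylor_bound[OF d1 d2 B(4) x y])
    have SD: "S\<^sup>2 \<le> d * D"
      using sum_squared_le_sum_of_squares[of "\<lambda>i. \<bar>y i - x i\<bar>" "{..<d}"] by (simp add: S_def D_def mult.commute)
    have asq: "a\<^sup>2 \<le> B\<^sup>2 * S\<^sup>2"
      using power_mono[OF a1, of 2] unfolding power_mult_distrib power2_abs by simp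
    have "f x * (a - L) \<le> B * (B * S\<^sup>2)"
    proof -
      have "f x * (a - L) \<le> \<bar>f x\<bar> * \<bar>a - L\<bar>" using abs_ge_self[of "f x * (a - L)"] unfolding abs_mult .
      also have "\<dots> \<le> B * (B * S\<^sup>2)" using B(1) B(2)[OF x] a2 by (intro mult_mono) auto
      finally show ?thesis .
    qed
    then have "(f y)\<^sup>2 - (f x)\<^sup>2 \<le> 2 * f x * L + 3 * B\<^sup>2 * S\<^sup>2"
    proof -
      have "(f y)\<^sup>2 - (f x)\<^sup>2 = 2 * (f x * (a - L)) + 2 * f x * L + a\<^sup>2"
        unfolding a_def by (simp add: power2_eq_square algebra_simps)
      moreover have "2 * (B * (B * S\<^sup>2)) + B\<^sup>2 * S\<^sup>2 = 3 * B\<^sup>2 * S\<^sup>2" by (simp add: power2_eq_square)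
      ultimately show ?thesis using asq \<open>f x * (a - L) \<le> B * (B * S\<^sup>2)\<close> by linarith
    qed
    also have "\<dots> \<le> 2 * f x * L + 3 * B\<^sup>2 * (d * D)"
      using SD by (intro add_left_mono mult_left_mono) auto
    finally have diff: "((f y)\<^sup>2 + \<epsilon>) - F \<le> 2 * f x * L + 3 * B\<^sup>2 * d * D" by (simp add: F_def mult.assoc)
    have pos: "(f y)\<^sup>2 + \<epsilon> > 0" using \<epsilon> by (simp add: add_nonneg_pos)
    have "ln ((f y)\<^sup>2 + \<epsilon>) - ln F \<le> ((f y)\<^sup>2 + \<epsilon> - F) / F"
      by (rule ln_diff_le[OF pos F(1)])
    also have "\<dots> \<le> (2 * f x * L + 3 * B\<^sup>2 * d * D) / F"
      using diff F by (intro divide_right_mono) auto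
    also have "\<dots> = 2 * f x * L / F + 3 * B\<^sup>2 * d * D / F" by (simp add: add_divide_distrib)
    also have "3 * B\<^sup>2 * d * D / F \<le> 3 * B\<^sup>2 * d * D / \<epsilon>"
      using F \<epsilon> by (intro divide_left_mono mult_nonneg_nonneg) (auto simp: D_def intro!: sum_nonneg)
    also have "2 * f x * L / F = (\<Sum>i<d. 2 * f x * partial_deriv i f x / F * (y i - x i))"
      by (simp add: L_def sum_distrib_left sum_divide_distrib mult.assoc)
    finally show "ln ((f y)\<^sup>2 + \<epsilon>) \<le> ln ((f x)\<^sup>2 + \<epsilon>) + (\<Sum>i<d. 2 * f x * partial_deriv i f x / ((f x)\<^sup>2 + \<epsilon>) * (y i - x i))
      + (2 * (3 * B\<^sup>2 * d / \<epsilon>)) / 2 * (\<Sum>i<d. (y i - x i)\<^sup>2)"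
      unfolding F_def D_def by (simp add: mult_ac)
  qed
qed

section \<open>Entropy under perturbation of the measure and of the function\<close>

lemma abs_mult_ln_le:
  fixes x :: real
  assumes "x > 0"
  shows "\<bar>x * ln x\<bar> \<le> 1 + x\<^sup>2"
proof -
  have "ln x \<le> x - 1" using ln_le_minus_one[OF assms] .
  then have "x * ln x \<le> x * (x - 1)" using assms by (intro mult_left_mono) auto
  moreover have "x * (x - 1) = x\<^sup>2 - x" by (simp add: power2_eq_square algebra_simps)
  ultimately have 1: "x * ln x \<le> x\<^sup>2" using assms by linarith
  have "ln (1 / x) \<le> 1 / x - 1" using assms by (intro ln_le_minus_one) auto
  then have "x * (- ln x) \<le> x * (1 / x - 1)" using assms by (intro mult_left_mono) (auto simp: ln_div)
  also have "\<dots> \<le> 1" using assms by (simp add: algebra_simps)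
  finally show ?thesis using 1 zero_le_power2[of x] by linarith
qed

text \<open>
  At \<open>a = 0\<close> the limit is the convention \<open>0 ln 0 = 0\<close>, which is the continuous extension of
  \<open>x ln x\<close>.
\<close>

lemma tendsto_mult_ln_shift:
  fixes a :: real
  assumes "a \<ge> 0"
  shows "(\<lambda>n. (a + 1 / real (Suc n)) * ln (a + 1 / real (Suc n))) \<longlonglongrightarrow> a * ln a"
proof (cases "a = 0")
  case True
  have "(\<lambda>n. 1 / real (Suc n) * ln (1 / real (Suc n))) \<longlonglongrightarrow> 0" by real_asymp
  then show ?thesis using True by simp
next
  case False
  have "(\<lambda>n. 1 / real (Suc n)) \<longlonglongrightarrow> 0" by real_asymp
  then have "(\<lambda>n. a + 1 / real (Suc n)) \<longlonglongrightarrow> a + 0" by (intro tendsto_intros)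
  then have "(\<lambda>n. (a + 1 / real (Suc n)) * ln (a + 1 / real (Suc n))) \<longlonglongrightarrow> (a + 0) * ln (a + 0)"
    using False by (intro tendsto_mult tendsto_ln) auto
  then show ?thesis by simp
qed

lemma (in prob_space) Ent_shift_tendsto:
  fixes F :: "'a \<Rightarrow> real"
  assumes [measurable]: "F \<in> borel_measurable M" and F: "\<And>x. x \<in> space M \<Longrightarrow> 0 \<le> F x" "\<And>x. x \<in> space M \<Longrightarrow> F x \<le> B"
  shows "(\<lambda>n. Ent M (\<lambda>x. F x + 1 / real (Suc n))) \<longlonglongrightarrow> Ent M F"
proof -
  have int: "integrable M F" by (rule integrable_bounded[of _ B]) (use F in auto)
  have 1: "(\<lambda>n. \<integral>x. (F x + 1 / real (Suc n)) * ln (F x + 1 / real (Suc n)) \<partial>M) \<longlonglongrightarrow> (\<integral>x. F x * ln (F x) \<partial>M)"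
  proof (rule integral_dominated_convergence[where w = "\<lambda>_. 1 + (B + 1)\<^sup>2"])
    show "AE x in M. (\<lambda>n. (F x + 1 / real (Suc n)) * ln (F x + 1 / real (Suc n))) \<longlonglongrightarrow> F x * ln (F x)"
      using F(1) by (intro AE_I2 tendsto_mult_ln_shift) auto
    show "AE x in M. norm ((F x + 1 / real (Suc n)) * ln (F x + 1 / real (Suc n))) \<le> 1 + (B + 1)\<^sup>2" for n
    proof (rule AE_I2)
      fix x assume x: "x \<in> space M"
      define y where "y = F x + 1 / real (Suc n)"
      have "1 / real (Suc n) > 0" "1 / real (Suc n) \<le> 1" by simp_all
      then have y: "y > 0" "y \<le> B + 1" using F[OF x] unfolding y_def by linarith+
      have "\<bar>y * ln y\<bar> \<le> 1 + y\<^sup>2" by (rule abs_mult_ln_le[OF y(1)])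
      also have "\<dots> \<le> 1 + (B + 1)\<^sup>2" using y by (intro add_left_mono power_mono) auto
      finally show "norm ((F x + 1 / real (Suc n)) * ln (F x + 1 / real (Suc n))) \<le> 1 + (B + 1)\<^sup>2"
        by (simp add: y_def)
    qed
  qed (use int in auto)
  have 2: "(\<lambda>n. ((\<integral>x. F x \<partial>M) + 1 / real (Suc n)) * ln ((\<integral>x. F x \<partial>M) + 1 / real (Suc n))) \<longlonglongrightarrow> (\<integral>x. F x \<partial>M) * ln (\<integral>x. F x \<partial>M)"
    using F(1) by (intro tendsto_mult_ln_shift integral_nonneg_AE AE_I2)
  have "(\<integral>x. F x + 1 / real (Suc n) \<partial>M) = (\<integral>x. F x \<partial>M) + 1 / real (Suc n)" for n
    using int by (simp add: prob_space)
  then show ?thesis unfolding Ent_def using tendsto_diff[OF 1 2] by simp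
qed

lemma integral_density_le:
  fixes p q \<phi> :: "'a \<Rightarrow> real"
  assumes [measurable]: "p \<in> borel_measurable L" "q \<in> borel_measurable L" "\<phi> \<in> borel_measurable L"
    and p: "\<And>x. x \<in> space L \<Longrightarrow> 0 \<le> p x" and q: "\<And>x. x \<in> space L \<Longrightarrow> 0 \<le> q x"
    and pq: "\<And>x. x \<in> space L \<Longrightarrow> p x \<le> K * q x"
    and \<phi>: "\<And>x. x \<in> space L \<Longrightarrow> 0 \<le> \<phi> x" and int: "integrable (density L (\<lambda>x. ennreal (q x))) \<phi>"
  shows "(\<integral>x. \<phi> x \<partial>density L (\<lambda>x. ennreal (p x))) \<le> K * (\<integral>x. \<phi> x \<partial>density L (\<lambda>x. ennreal (q x)))"
proof -
  have i: "integrable L (\<lambda>x. q x * \<phi> x)" using int q by (subst (asm) integrable_density) auto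
  have "(\<integral>x. \<phi> x \<partial>density L (\<lambda>x. ennreal (p x))) = (\<integral>x. p x * \<phi> x \<partial>L)"
    using p by (subst integral_density) auto
  also have "\<dots> \<le> (\<integral>x. K * (q x * \<phi> x) \<partial>L)"
  proof (rule integral_mono_AE')
    show "AE x in L. p x * \<phi> x \<le> K * (q x * \<phi> x)"
    proof (rule AE_I2)
      fix x assume "x \<in> space L"
      then show "p x * \<phi> x \<le> K * (q x * \<phi> x)"
        using mult_right_mono[OF pq \<phi>] by (simp add: mult.assoc)
    qed
    show "AE x in L. 0 \<le> K * (q x * \<phi> x)"
    proof (rule AE_I2)
      fix x assume x: "x \<in> space L"
      have "0 \<le> K * q x" using p[OF x] pq[OF x] by linarith
      then have "0 \<le> (K * q x) * \<phi> x" using \<phi>[OF x] by (rule mult_nonneg_nonneg)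
      then show "0 \<le> K * (q x * \<phi> x)" by (simp add: mult.assoc)
    qed
  qed (use i in auto)
  also have "\<dots> = K * (\<integral>x. q x * \<phi> x \<partial>L)" by simp
  also have "(\<integral>x. q x * \<phi> x \<partial>L) = (\<integral>x. \<phi> x \<partial>density L (\<lambda>x. ennreal (q x)))"
    using q by (subst integral_density) auto
  finally show ?thesis .
qed

text \<open>
  For every \<open>c > 0\<close> the entropy of \<open>F\<close> is at most the integral of
  \<open>F ln F - F ln c - F + c\<close>, with equality when \<open>c\<close> is the mean of \<open>F\<close>. This integrand is nonnegative,
  so the bound on densities passes to the integral; \<open>c\<close> is taken to be the mean under \<open>N\<close>.
\<close>

lemma holley_stroock:
  fixes p q F :: "'a \<Rightarrow> real" and L :: "'a measure"
  defines "M \<equiv> density L (\<lambda>x. ennreal (p x))" and "N \<equiv> density L (\<lambda>x. ennreal (q x))"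
  assumes M: "prob_space M" and N: "prob_space N"
    and [measurable]: "p \<in> borel_measurable L" "q \<in> borel_measurable L" "F \<in> borel_measurable L"
    and p: "\<And>x. x \<in> space L \<Longrightarrow> 0 \<le> p x" and q: "\<And>x. x \<in> space L \<Longrightarrow> 0 \<le> q x"
    and pq: "\<And>x. x \<in> space L \<Longrightarrow> p x \<le> K * q x"
    and \<delta>: "\<delta> > 0" and F: "\<And>x. x \<in> space L \<Longrightarrow> \<delta> \<le> F x" "\<And>x. x \<in> space L \<Longrightarrow> F x \<le> B"
  shows "Ent M F \<le> K * Ent N F"
proof -
  interpret M: prob_space M by fact
  interpret N: prob_space N by fact
  have [measurable_cong]: "sets M = sets L" "sets N = sets L" by (simp_all add: M_def N_def)
  have sp: "space M = space L" "space N = space L" by (simp_all add: M_def N_def)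
  have lnb: "\<bar>F x * ln (F x)\<bar> \<le> 1 + B\<^sup>2" if "x \<in> space L" for x
  proof -
    have "\<bar>F x * ln (F x)\<bar> \<le> 1 + (F x)\<^sup>2" using abs_mult_ln_le[of "F x"] F(1)[OF that] \<delta> by simp
    also have "\<dots> \<le> 1 + B\<^sup>2" using F[OF that] \<delta> by (intro add_left_mono power_mono) auto
    finally show ?thesis .
  qed
  have absF: "\<bar>F x\<bar> \<le> B" if "x \<in> space L" for x using F[OF that] \<delta> by auto
  have intM: "integrable M F" "integrable M (\<lambda>x. F x * ln (F x))"
    by (rule M.integrable_bounded[of _ B] M.integrable_bounded[of _ "1 + B\<^sup>2"]; use absF lnb sp in simp)+
  have intN: "integrable N F" "integrable N (\<lambda>x. F x * ln (F x))"
    by (rule N.integrable_bounded[of _ B] N.integrable_bounded[of _ "1 + B\<^sup>2"]; use absF lnb sp in simp)+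
  define a where "a = (\<integral>x. F x \<partial>M)"
  define c where "c = (\<integral>x. F x \<partial>N)"
  have "\<delta> = (\<integral>x. \<delta> \<partial>M)" by (simp add: M.prob_space)
  also have "\<dots> \<le> a" unfolding a_def using intM F sp by (intro integral_mono) auto
  finally have a: "a > 0" using \<delta> by simp
  have "\<delta> = (\<integral>x. \<delta> \<partial>N)" by (simp add: N.prob_space)
  also have "\<dots> \<le> c" unfolding c_def using intN F sp by (intro integral_mono) auto
  finally have c: "c > 0" using \<delta> by simp
  have tangent: "x * ln c + x - c \<le> x * ln x" if "x > 0" for x
  proof -
    have "ln (c / x) \<le> c / x - 1" using that c by (intro ln_le_minus_one) auto
    then have "x * (ln c - ln x) \<le> x * (c / x - 1)" using that c by (intro mult_left_mono) (auto simp: ln_div)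
    also have "\<dots> = c - x" using that by (simp add: algebra_simps)
    finally show ?thesis by (simp add: algebra_simps)
  qed
  let ?\<phi> = "\<lambda>x. F x * ln (F x) - F x * ln c - F x + c"
  have "Ent M F \<le> (\<integral>x. F x * ln (F x) \<partial>M) - a * ln c - a + c"
    using tangent[OF a] unfolding Ent_def a_def by simp
  also have "\<dots> = (\<integral>x. ?\<phi> x \<partial>M)" unfolding a_def using intM by (simp add: M.prob_space)
  also have "\<dots> \<le> K * (\<integral>x. ?\<phi> x \<partial>N)"
    unfolding M_def N_def
  proof (rule integral_density_le[OF _ _ _ p q pq])
    fix x assume "x \<in> space L"
    then have "F x > 0" using F(1) \<delta> by force
    from tangent[OF this] show "0 \<le> ?\<phi> x" by simp
  next
    show "integrable (density L (\<lambda>x. ennreal (q x))) ?\<phi>"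
      unfolding N_def[symmetric] using intN by simp
  qed auto
  also have "(\<integral>x. ?\<phi> x \<partial>N) = (\<integral>x. F x * ln (F x) \<partial>N) - c * ln c - c + c"
    unfolding c_def using intN by (simp add: N.prob_space)
  also have "\<dots> = Ent N F" by (simp add: Ent_def c_def)
  finally show ?thesis .
qed

section \<open>A strongly convex potential close to the quartic one\<close>

text \<open>
  The quartic potential has a degenerate Hessian at the origin. Inside the unit ball it is replaced
  by its tangent paraboloid \<open>|x|\<^sup>2 / 2 - 1 / 4\<close>, which meets it to first order on the unit
  sphere; outside the ball the formula equals \<open>|x| ^ 4 / 4\<close>. In this form the potential is visibly
  \<open>|x|\<^sup>2 / 2\<close> plus a convex function.
\<close>

definition convexified_quartic :: "nat \<Rightarrow> (nat \<Rightarrow> real) \<Rightarrow> real" where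
  "convexified_quartic d x = (eucl_norm d x)\<^sup>2 / 2 + (max ((eucl_norm d x)\<^sup>2 - 1) 0)\<^sup>2 / 4 - 1 / 4"

lemma eucl_norm_squared: "(eucl_norm d x)\<^sup>2 = (\<Sum>i<d. (x i)\<^sup>2)"
  by (simp add: L2_set_def sum_nonneg)

lemma eucl_norm_pow4: "eucl_norm d x ^ 4 = ((eucl_norm d x)\<^sup>2)\<^sup>2"
  by (simp flip: power_mult)

lemma eucl_norm_measurable [measurable]: "eucl_norm d \<in> borel_measurable (lborel_dim d)"
  unfolding L2_set_def by measurable

lemma convexified_quartic_measurable [measurable]:
  "convexified_quartic d \<in> borel_measurable (lborel_dim d)"
  unfolding convexified_quartic_def by measurable

text \<open>
  With \<open>q = |x|\<^sup>2\<close>, the difference of the two potentials is \<open>(1 - q)\<^sup>2 / 4\<close> for \<open>q < 1\<close> and zero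
  otherwise. Its oscillation does not depend on the dimension, which is where the universality of
  the final constant comes from.
\<close>

lemma convexified_quartic_bounds:
  "convexified_quartic d x \<le> eucl_norm d x ^ 4 / 4" "eucl_norm d x ^ 4 / 4 \<le> convexified_quartic d x + 1 / 4"
proof -
  define q where "q = (eucl_norm d x)\<^sup>2"
  have q: "q \<ge> 0" by (simp add: q_def)
  have "convexified_quartic d x = (if q \<ge> 1 then q\<^sup>2 / 4 else q / 2 - 1 / 4)"
    unfolding convexified_quartic_def q_def[symmetric] by (auto simp: power2_eq_square field_simps max_def)
  moreover have "q\<^sup>2 / 4 - (q / 2 - 1 / 4) = (1 - q)\<^sup>2 / 4" by (simp add: power2_eq_square field_simps)
  moreover have "(1 - q)\<^sup>2 \<le> 1" if "q < 1" using q that by (simp add: power_le_one)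
  moreover have "(1 - q)\<^sup>2 \<ge> 0" by simp
  ultimately have "convexified_quartic d x \<le> q\<^sup>2 / 4 \<and> q\<^sup>2 / 4 \<le> convexified_quartic d x + 1 / 4"
    by (cases "q \<ge> 1") (simp, smt (verit) divide_le_cancel divide_nonneg_pos)
  then show "convexified_quartic d x \<le> eucl_norm d x ^ 4 / 4" "eucl_norm d x ^ 4 / 4 \<le> convexified_quartic d x + 1 / 4"
    unfolding eucl_norm_pow4 q_def[symmetric] by simp_all
qed

text \<open>
  The term \<open>|x|\<^sup>2 / 2\<close> accounts for exactly the strong convexity, by the parallelogram-type identity
  \<open>(t a + s b)\<^sup>2 + t s (a - b)\<^sup>2 = t a\<^sup>2 + s b\<^sup>2\<close> for \<open>t + s = 1\<close>. The rest is a convex nondecreasing function of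
  \<open>|x|\<^sup>2\<close>.
\<close>

lemma strongly_convex_convexified_quartic:
  "strongly_convex d (\<lambda>x. convexified_quartic d x + k)"
  unfolding strongly_convex_def
proof (intro ballI allI impI)
  fix x y :: "nat \<Rightarrow> real" and t s :: real
  assume "x \<in> dim_space d" "y \<in> dim_space d" and ts: "t > 0" "s > 0" "t + s = 1"
  define z where "z = (\<lambda>i\<in>{..<d}. t * x i + s * y i)"
  define D where "D = (\<Sum>i<d. (x i - y i)\<^sup>2)"
  define qx qy qz where "qx = (eucl_norm d x)\<^sup>2" and "qy = (eucl_norm d y)\<^sup>2" and "qz = (eucl_norm d z)\<^sup>2"
  have s: "s = 1 - t" using ts by simp
  have id: "(t * a + s * b)\<^sup>2 + t * s * (a - b)\<^sup>2 = t * a\<^sup>2 + s * b\<^sup>2" for a b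
    unfolding s by (simp add: power2_eq_square algebra_simps)
  have "qz + t * s * D = (\<Sum>i<d. (t * x i + s * y i)\<^sup>2 + t * s * (x i - y i)\<^sup>2)"
    by (simp add: qz_def D_def eucl_norm_squared z_def sum.distrib sum_distrib_left)
  also have "\<dots> = t * qx + s * qy"
    unfolding id by (simp add: qx_def qy_def eucl_norm_squared sum.distrib sum_distrib_left)
  finally have quad: "qz + t * s * D = t * qx + s * qy" .
  have "D \<ge> 0" by (simp add: D_def sum_nonneg)
  then have "t * s * D \<ge> 0" using ts by simp
  then have "qz - 1 \<le> t * (qx - 1) + s * (qy - 1)" using quad ts(3) by (simp add: algebra_simps)
  also have "\<dots> \<le> t * max (qx - 1) 0 + s * max (qy - 1) 0"
    using ts by (intro add_mono mult_left_mono) auto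
  finally have "max (qz - 1) 0 \<le> t * max (qx - 1) 0 + s * max (qy - 1) 0" using ts by simp
  then have "(max (qz - 1) 0)\<^sup>2 \<le> (t * max (qx - 1) 0 + s * max (qy - 1) 0)\<^sup>2" by (intro power_mono) auto
  also have "\<dots> \<le> t * (max (qx - 1) 0)\<^sup>2 + s * (max (qy - 1) 0)\<^sup>2"
  proof -
    have "t * s * (a - b)\<^sup>2 \<ge> 0" for a b using ts by simp
    then show ?thesis using id by (metis le_add_same_cancel1)
  qed
  finally have "(max (qz - 1) 0)\<^sup>2 / 4 \<le> t * ((max (qx - 1) 0)\<^sup>2 / 4) + s * ((max (qy - 1) 0)\<^sup>2 / 4)" by simp
  moreover have "qz / 2 + t * s / 2 * D = t * (qx / 2) + s * (qy / 2)" using quad by (simp add: field_simps)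
  ultimately have "qz / 2 + (max (qz - 1) 0)\<^sup>2 / 4 + t * s / 2 * D \<le> t * (qx / 2 + (max (qx - 1) 0)\<^sup>2 / 4) + s * (qy / 2 + (max (qy - 1) 0)\<^sup>2 / 4)"
    by (simp add: distrib_left)
  moreover have "t * (a - 1 / 4 + k) + s * (b - 1 / 4 + k) = t * a + s * b - 1 / 4 + k" for a b
    unfolding s by (simp add: field_simps)
  ultimately show "convexified_quartic d (\<lambda>i\<in>{..<d}. t * x i + s * y i) + k + t * s / 2 * (\<Sum>i<d. (x i - y i)\<^sup>2)
    \<le> t * (convexified_quartic d x + k) + s * (convexified_quartic d y + k)"
    unfolding convexified_quartic_def z_def[symmetric] D_def[symmetric] qx_def[symmetric] qy_def[symmetric] qz_def[symmetric]
    by simp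
qed

lemma quartic_partition_function_pos: "(\<integral>y. exp (- (eucl_norm d y ^ 4 / 4)) \<partial>lborel_dim d) > 0" (is "?Z > 0")
proof -
  interpret prob_space "quartic_measure d" by (rule prob_space_quartic_measure)
  have "?Z \<noteq> 0"
  proof
    assume "?Z = 0"
    then have "emeasure (quartic_measure d) (space (quartic_measure d)) = 0"
      unfolding quartic_measure_def by (simp add: emeasure_density)
    then show False using emeasure_space_1 by simp
  qed
  moreover have "?Z \<ge> 0" by (intro integral_nonneg_AE) auto
  ultimately show ?thesis by linarith
qed

text \<open>
  Bounds on the unnormalized densities carry over to the normalized ones at no loss: the partition
  functions are ordered in the same way as the densities, so only one factor \<open>exp (1 / 4)\<close> appears in
  each direction. The number \<open>k\<close> is the logarithm of the new partition function.
\<close>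

lemma convexified_quartic_comparison:
  obtains k where "prob_space (log_density_measure d (\<lambda>x. convexified_quartic d x + k))"
    and "\<And>x. exp (- (eucl_norm d x ^ 4 / 4)) / (\<integral>y. exp (- (eucl_norm d y ^ 4 / 4)) \<partial>lborel_dim d)
      \<le> exp (1 / 4) * exp (- (convexified_quartic d x + k))"
    and "\<And>x. exp (- (convexified_quartic d x + k))
      \<le> exp (1 / 4) * (exp (- (eucl_norm d x ^ 4 / 4)) / (\<integral>y. exp (- (eucl_norm d y ^ 4 / 4)) \<partial>lborel_dim d))"
proof -
  let ?V = "\<lambda>x. eucl_norm d x ^ 4 / 4" and ?U = "convexified_quartic d"
  define Z where "Z = (\<integral>y. exp (- ?V y) \<partial>lborel_dim d)"
  define Y where "Y = (\<integral>y. exp (- ?U y) \<partial>lborel_dim d)"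
  have Z: "Z > 0" unfolding Z_def by (rule quartic_partition_function_pos)
  have VU: "exp (- ?V x) \<le> exp (- ?U x)" for x using convexified_quartic_bounds(1)[where d = d and x = x] by simp
  have UV: "exp (- ?U x) \<le> exp (1 / 4) * exp (- ?V x)" for x
    using convexified_quartic_bounds(2)[where d = d and x = x] by (simp flip: exp_add)
  have intU: "integrable (lborel_dim d) (\<lambda>x. exp (- ?U x))"
  proof (rule Bochner_Integration.integrable_bound)
    show "integrable (lborel_dim d) (\<lambda>x. exp (1 / 4) * exp (- ?V x))"
      by (intro integrable_mult_right quartic_integrable)
    show "AE x in lborel_dim d. norm (exp (- ?U x)) \<le> norm (exp (1 / 4) * exp (- ?V x))"
      using UV by (intro AE_I2) simp
  qed measurable
  have ZY: "Z \<le> Y" unfolding Z_def Y_def by (intro integral_mono quartic_integrable intU VU)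
  have "Y \<le> (\<integral>y. exp (1 / 4) * exp (- ?V y) \<partial>lborel_dim d)"
    unfolding Y_def by (intro integral_mono intU integrable_mult_right quartic_integrable UV)
  then have YZ: "Y \<le> exp (1 / 4) * Z" by (simp add: Z_def)
  have Y: "Y > 0" using Z ZY by simp
  have shift: "exp (- (?U x + ln Y)) = exp (- ?U x) / Y" for x
  proof -
    have "- (?U x + ln Y) = - ?U x - ln Y" by simp
    then show ?thesis by (simp only: exp_diff exp_ln[OF Y])
  qed
  show ?thesis
  proof (rule that[of "ln Y"])
    show "prob_space (log_density_measure d (\<lambda>x. ?U x + ln Y))"
    proof
      have "(\<integral>\<^sup>+x. ennreal (exp (- ?U x) / Y) \<partial>lborel_dim d) = ennreal (\<integral>x. exp (- ?U x) / Y \<partial>lborel_dim d)"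
      proof (rule nn_integral_eq_integral)
        show "integrable (lborel_dim d) (\<lambda>x. exp (- ?U x) / Y)" by (intro integrable_divide intU)
      qed (use Y in simp)
      also have "\<dots> = 1" using Y by (simp add: Y_def[symmetric])
      finally show "emeasure (log_density_measure d (\<lambda>x. ?U x + ln Y)) (space (log_density_measure d (\<lambda>x. ?U x + ln Y))) = 1"
        unfolding log_density_measure_def shift by (simp add: emeasure_density cong: nn_integral_cong_simp)
    qed
    fix x
    have "exp (- ?V x) / Z \<le> exp (- ?U x) / (Y / exp (1 / 4))"
      using VU[of x] YZ Y Z by (intro frac_le) (auto simp: field_simps)
    then show "exp (- ?V x) / (\<integral>y. exp (- ?V y) \<partial>lborel_dim d) \<le> exp (1 / 4) * exp (- (?U x + ln Y))"
      unfolding shift Z_def[symmetric] by (simp add: mult.commute)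
    have "exp (- ?U x) / Y \<le> exp (1 / 4) * exp (- ?V x) / Z"
      using UV[of x] ZY Z by (intro frac_le) auto
    then show "exp (- (?U x + ln Y)) \<le> exp (1 / 4) * (exp (- ?V x) / (\<integral>y. exp (- ?V y) \<partial>lborel_dim d))"
      unfolding shift Z_def[symmetric] by simp
  qed
qed

section \<open>The logarithmic Sobolev inequality for the quartic measure\<close>

lemma Cc_infinity_measurable:
  assumes "f \<in> Cc_infinity d"
  shows "f \<in> borel_measurable (lborel_dim d)"
    and "i < d \<Longrightarrow> partial_deriv i f \<in> borel_measurable (lborel_dim d)"
proof -
  have "C_k d (Suc 0) f" using assms unfolding Cc_infinity_def by blast
  then show "f \<in> borel_measurable (lborel_dim d)"
    and "i < d \<Longrightarrow> partial_deriv i f \<in> borel_measurable (lborel_dim d)"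
    by (auto intro!: borel_measurable_continuous_on_dim_space)
qed

lemma grad_norm_squared: "(eucl_norm d (grad d f x))\<^sup>2 = (\<Sum>i<d. (partial_deriv i f x)\<^sup>2)"
  unfolding eucl_norm_squared grad_def by simp

lemma grad_norm_squared_measurable:
  assumes "f \<in> Cc_infinity d"
  shows "(\<lambda>x. (eucl_norm d (grad d f x))\<^sup>2) \<in> borel_measurable (lborel_dim d)"
  unfolding grad_norm_squared
  by (intro borel_measurable_sum borel_measurable_power Cc_infinity_measurable(2)[OF assms]) auto

lemma Cc_infinity_squares_bounded:
  assumes "f \<in> Cc_infinity d"
  shows "\<exists>B\<ge>0. \<forall>x\<in>dim_space d. (f x)\<^sup>2 \<le> B \<and> (eucl_norm d (grad d f x))\<^sup>2 \<le> B"
proof -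
  obtain b where b: "b > 0" "\<And>x. x \<in> dim_space d \<Longrightarrow> \<bar>f x\<bar> \<le> b"
    "\<And>i x. i < d \<Longrightarrow> x \<in> dim_space d \<Longrightarrow> \<bar>partial_deriv i f x\<bar> \<le> b"
    using Cc_infinity_bounds[OF assms] by blast
  have sq: "a\<^sup>2 \<le> b\<^sup>2" if "\<bar>a\<bar> \<le> b" for a
    using that b(1) by (auto simp: abs_le_square_iff[symmetric])
  show ?thesis
  proof (intro exI[of _ "b\<^sup>2 + d * b\<^sup>2"] conjI ballI)
    fix x assume x: "x \<in> dim_space d"
    have "(f x)\<^sup>2 \<le> b\<^sup>2" by (intro sq b(2) x)
    then show "(f x)\<^sup>2 \<le> b\<^sup>2 + d * b\<^sup>2" by (simp add: add_increasing2)
    have "(eucl_norm d (grad d f x))\<^sup>2 \<le> (\<Sum>i<d. b\<^sup>2)"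
      unfolding grad_norm_squared using b(3)[OF _ x] by (intro sum_mono sq) auto
    then show "(eucl_norm d (grad d f x))\<^sup>2 \<le> b\<^sup>2 + d * b\<^sup>2" by (simp add: add_increasing)
  qed simp
qed

text \<open>
  Apply \<open>log_sobolev_strongly_convex_exp\<close> to \<open>g = ln (f\<^sup>2 + \<epsilon>)\<close>. Adding \<open>\<epsilon>\<close> keeps \<open>g\<close> bounded where \<open>f\<close>
  vanishes, and costs nothing on the right:
  \<open>|\<nabla>g|\<^sup>2 exp g = 4 f\<^sup>2 |\<nabla>f|\<^sup>2 / (f\<^sup>2 + \<epsilon>) \<le> 4 |\<nabla>f|\<^sup>2\<close>.
\<close>

lemma log_sobolev_strongly_convex:
  fixes d :: nat and W :: "(nat \<Rightarrow> real) \<Rightarrow> real"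
  defines "N \<equiv> log_density_measure d W"
  assumes W: "W \<in> borel_measurable (lborel_dim d)" and prob: "prob_space N" and conv: "strongly_convex d W"
    and f: "f \<in> Cc_infinity d" and \<epsilon>: "\<epsilon> > 0"
  shows "Ent N (\<lambda>x. (f x)\<^sup>2 + \<epsilon>) \<le> 2 * (\<integral>x. (eucl_norm d (grad d f x))\<^sup>2 \<partial>N)"
proof -
  interpret prob_space N by fact
  have [measurable_cong]: "sets N = sets (lborel_dim d)" by (simp add: N_def sets_log_density_measure)
  have sp: "space N = dim_space d" by (simp add: N_def)
  note fm [measurable] = Cc_infinity_measurable(1)[OF f] and dm [measurable] = Cc_infinity_measurable(2)[OF f]
  obtain B where B: "B \<ge> 0" "\<And>x. x \<in> dim_space d \<Longrightarrow> (f x)\<^sup>2 \<le> B"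
    "\<And>x. x \<in> dim_space d \<Longrightarrow> (eucl_norm d (grad d f x))\<^sup>2 \<le> B"
    using Cc_infinity_squares_bounded[OF f] by blast
  obtain C where C: "\<And>x y. x \<in> dim_space d \<Longrightarrow> y \<in> dim_space d \<Longrightarrow>
    ln ((f y)\<^sup>2 + \<epsilon>) \<le> ln ((f x)\<^sup>2 + \<epsilon>) + (\<Sum>i<d. 2 * f x * partial_deriv i f x / ((f x)\<^sup>2 + \<epsilon>) * (y i - x i))
      + C / 2 * (\<Sum>i<d. (y i - x i)\<^sup>2)"
    using log_square_semiconcave[OF f \<epsilon>] by blast
  define G where "G = (\<lambda>x. (eucl_norm d (grad d f x))\<^sup>2)"
  have [measurable]: "G \<in> borel_measurable (lborel_dim d)"
    unfolding G_def by (rule grad_norm_squared_measurable[OF f])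
  have G0: "G x \<ge> 0" for x by (simp add: G_def)
  have GB: "G x \<le> B" if "x \<in> dim_space d" for x using B(3)[OF that] by (simp add: G_def)
  let ?F = "\<lambda>x. (f x)\<^sup>2 + \<epsilon>" and ?p = "\<lambda>i x. 2 * f x * partial_deriv i f x / ((f x)\<^sup>2 + \<epsilon>)"
  have F: "?F x > 0" "?F x \<ge> \<epsilon>" for x using \<epsilon> by (auto simp: add_nonneg_pos)
  have P: "(\<Sum>i<d. (?p i x)\<^sup>2) = 4 * (f x)\<^sup>2 * G x / (?F x)\<^sup>2" for x
    unfolding G_def grad_norm_squared by (simp add: sum_distrib_left sum_divide_distrib power_mult_distrib power_divide)
  have PF: "(\<Sum>i<d. (?p i x)\<^sup>2) * ?F x \<le> 4 * G x" for x
  proof -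
    have "(\<Sum>i<d. (?p i x)\<^sup>2) * ?F x = 4 * G x * ((f x)\<^sup>2 / ?F x)"
      unfolding P using F(1)[of x] by (simp add: power2_eq_square)
    also have "\<dots> \<le> 4 * G x * 1" using F(1)[of x] \<epsilon> G0 by (intro mult_left_mono) auto
    finally show ?thesis by simp
  qed
  have PQ: "(\<Sum>i<d. (?p i x)\<^sup>2) \<le> 4 * B / \<epsilon>" if "x \<in> dim_space d" for x
  proof -
    have "(\<Sum>i<d. (?p i x)\<^sup>2) \<le> 4 * G x / ?F x" using PF[of x] F(1)[of x] by (simp add: pos_le_divide_eq)
    also have "\<dots> \<le> 4 * B / \<epsilon>"
      using GB[OF that] G0 F \<epsilon> B(1) by (intro frac_le) auto
    finally show ?thesis .
  qed
  have lnB: "\<bar>ln (?F x)\<bar> \<le> \<bar>ln \<epsilon>\<bar> + \<bar>ln (B + \<epsilon>)\<bar>" if "x \<in> dim_space d" for x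
  proof -
    have "ln \<epsilon> \<le> ln (?F x)" using F \<epsilon> by (subst ln_le_cancel_iff) auto
    moreover have "ln (?F x) \<le> ln (B + \<epsilon>)" using B(2)[OF that] F(1)[of x] by (intro ln_mono) auto
    ultimately show ?thesis by linarith
  qed
  have "Ent N (\<lambda>x. exp (ln (?F x))) \<le> 1 / 2 * (\<integral>x. (\<Sum>i<d. (?p i x)\<^sup>2) * exp (ln (?F x)) \<partial>N)"
    unfolding N_def
    by (rule log_sobolev_strongly_convex_exp[OF W prob[unfolded N_def] conv _ lnB _ PQ C]) (auto, measurable)
  then have "Ent N ?F \<le> 1 / 2 * (\<integral>x. (\<Sum>i<d. (?p i x)\<^sup>2) * ?F x \<partial>N)"
    using F by simp
  also have "(\<integral>x. (\<Sum>i<d. (?p i x)\<^sup>2) * ?F x \<partial>N) \<le> (\<integral>x. 4 * G x \<partial>N)"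
  proof (rule integral_mono_AE')
    show "integrable N (\<lambda>x. 4 * G x)"
      by (intro integrable_mult_right integrable_bounded[of _ B]) (use G0 GB sp in auto)
  qed (use PF G0 in auto)
  finally show ?thesis by (simp add: G_def)
qed

theorem theorem4p2:
  "\<exists>c::real. c > 0 \<and>
     (\<forall>d\<ge>1. \<forall>f\<in>Cc_infinity d.
        Ent (quartic_measure d) (\<lambda>x. (f x)\<^sup>2)
          \<le> c * (\<integral>x. (eucl_norm d (grad d f x))\<^sup>2 \<partial>quartic_measure d))"
\<comment> \<open>The factor 2 is the constant for a potential with Hessian at least the identity; the density
  comparison is used once on the entropy and once on the gradient term, each time at the cost
  of \<open>exp (1 / 4)\<close>.\<close>
proof (intro exI[of _ "2 * exp (1 / 2)"] conjI allI impI ballI)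
  fix d :: nat and f assume f: "f \<in> Cc_infinity d"
  obtain k where k: "prob_space (log_density_measure d (\<lambda>x. convexified_quartic d x + k))"
    and le1: "\<And>x. exp (- (eucl_norm d x ^ 4 / 4)) / (\<integral>y. exp (- (eucl_norm d y ^ 4 / 4)) \<partial>lborel_dim d)
      \<le> exp (1 / 4) * exp (- (convexified_quartic d x + k))"
    and le2: "\<And>x. exp (- (convexified_quartic d x + k))
      \<le> exp (1 / 4) * (exp (- (eucl_norm d x ^ 4 / 4)) / (\<integral>y. exp (- (eucl_norm d y ^ 4 / 4)) \<partial>lborel_dim d))"
    using convexified_quartic_comparison[of d] by blast
  let ?M = "quartic_measure d"
  define N where "N = log_density_measure d (\<lambda>x. convexified_quartic d x + k)"
  let ?G = "\<lambda>x. (eucl_norm d (grad d f x))\<^sup>2"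
  interpret M: prob_space ?M by (rule prob_space_quartic_measure)
  interpret N: prob_space N unfolding N_def by (rule k)
  note Z = quartic_partition_function_pos[of d]
  have [measurable_cong]: "sets ?M = sets (lborel_dim d)" by (simp add: quartic_measure_def)
  have sp: "space ?M = dim_space d" by (simp add: quartic_measure_def space_PiM)
  note fm [measurable] = Cc_infinity_measurable(1)[OF f] and Gm = grad_norm_squared_measurable[OF f]
  obtain B where B: "B \<ge> 0" "\<And>x. x \<in> dim_space d \<Longrightarrow> (f x)\<^sup>2 \<le> B" "\<And>x. x \<in> dim_space d \<Longrightarrow> ?G x \<le> B"
    using Cc_infinity_squares_bounded[OF f] by blast
  have bound: "Ent ?M (\<lambda>x. (f x)\<^sup>2 + \<epsilon>) \<le> 2 * exp (1 / 2) * (\<integral>x. ?G x \<partial>?M)" if \<epsilon>: "\<epsilon> > 0" for \<epsilon>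
  proof -
    have "Ent ?M (\<lambda>x. (f x)\<^sup>2 + \<epsilon>) \<le> exp (1 / 4) * Ent N (\<lambda>x. (f x)\<^sup>2 + \<epsilon>)"
      unfolding quartic_measure_def N_def log_density_measure_def
    proof (rule holley_stroock[where \<delta> = \<epsilon> and B = "B + \<epsilon>"])
      show "prob_space (density (lborel_dim d) (\<lambda>x. ennreal (exp (- (convexified_quartic d x + k)))))"
        using k unfolding log_density_measure_def .
    qed (use le1 B Z \<epsilon> M.prob_space_axioms[unfolded quartic_measure_def] in \<open>auto simp: space_PiM less_imp_le\<close>)
    also have "\<dots> \<le> exp (1 / 4) * (2 * (\<integral>x. ?G x \<partial>N))"
      unfolding N_def
      by (intro mult_left_mono log_sobolev_strongly_convex strongly_convex_convexified_quartic k f \<epsilon>) auto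
    also have "(\<integral>x. ?G x \<partial>N) \<le> exp (1 / 4) * (\<integral>x. ?G x \<partial>?M)"
      unfolding quartic_measure_def N_def log_density_measure_def
    proof (rule integral_density_le[OF _ _ Gm])
      have "integrable ?M ?G"
        by (rule M.integrable_bounded[of _ B]) (use Gm B sp in auto)
      then show "integrable (density (lborel_dim d) (\<lambda>x. ennreal (exp (- (eucl_norm d x ^ 4 / 4)) / (\<integral>y. exp (- (eucl_norm d y ^ 4 / 4)) \<partial>lborel_dim d)))) ?G"
        unfolding quartic_measure_def .
    qed (use le2 Z in \<open>auto simp: less_imp_le\<close>)
    also have "exp (1 / 4) * (2 * (exp (1 / 4) * (\<integral>x. ?G x \<partial>?M))) = 2 * exp (1 / 2) * (\<integral>x. ?G x \<partial>?M)"
    proof -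
      have "exp (1 / 4) * exp (1 / 4) = exp (1 / 2 :: real)" by (simp flip: exp_add)
      then show ?thesis by (metis (no_types, lifting) mult.assoc mult.left_commute)
    qed
    finally show ?thesis by simp
  qed
  have "(\<lambda>n. Ent ?M (\<lambda>x. (f x)\<^sup>2 + 1 / real (Suc n))) \<longlonglongrightarrow> Ent ?M (\<lambda>x. (f x)\<^sup>2)"
    by (rule M.Ent_shift_tendsto[where B = B]) (use B sp in auto)
  then show "Ent ?M (\<lambda>x. (f x)\<^sup>2) \<le> 2 * exp (1 / 2) * (\<integral>x. ?G x \<partial>?M)"
    by (rule LIMSEQ_le_const2) (auto intro!: bound)
qed simp

end
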